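(* Let $n\ge 8$ with $n\equiv 0\pmod 4$. Among all connected graphs on $n$ vertices with dissociation number $4$, the graph $\widehat{\mathcal{T}}_{n,4}$ is the unique graph with the minimum spectral radius.
   Context: The spectral radius of a graph is the largest eigenvalue of its adjacency matrix. The dissociation number of $G$ is the largest size of a vertex set inducing a subgraph of maximum degree at most $1$. For even $d$, $CP_d$ is the complement of a perfect matching in $K_d$; for odd $d$, $L_d=CP_{d-1}\vee K_1$. For $n\ge 8$, $\widehat{\mathcal{T}}_{n,4}$ is the graph obtained from disjoint graphs $C_1,C_2$ on $n_1,n_2$ vertices with $n_1+n_2=n$, $|n_1-n_2|\le 1$, $C_i=CP_{n_i}$ if $n_i$ even and $C_i=L_{n_i}$ if $n_i$ odd, by adding one edge $uv$ with $u\in C_1$ of degree $n_1-2$ in $C_1$ and $v\in C_2$ of degree $n_2-2$ in $C_2$. For $n\equiv 0\pmod 4$ this is two copies of $CP_{n/2}$ joined by a single edge. *)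

theory Defs
  imports
    "Graph_Theory.Digraph_Isomorphism"
    "Graph_Theory.Pair_Digraph"
    "Jordan_Normal_Form.Spectral_Radius"
begin

text \<open>
  Finite simple graphs are the symmetric loop-free digraphs of the locale \<^locale>\<open>pair_graph\<close>: an
  undirected edge is a pair of opposite arcs, so the degree of a vertex is its out-degree.
\<close>

text \<open>
  The rows and columns are indexed through an arbitrary enumeration of the vertices; a different
  enumeration gives a matrix that is conjugate by a permutation matrix, hence the same spectrum.
\<close>
definition adjacency_matrix :: "'a pair_pre_digraph \<Rightarrow> real mat" where
  "adjacency_matrix G =
     (let vs = (SOME vs. distinct vs \<and> set vs = pverts G)
      in mat (length vs) (length vs) (\<lambda>(i, j). if (vs ! i, vs ! j) \<in> parcs G then 1 else 0))"

text \<open>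
  This is the largest eigenvalue; the constant \<^const>\<open>spectral_radius\<close> is the largest modulus of a
  complex eigenvalue instead.
\<close>
definition graph_spectral_radius :: "'a pair_pre_digraph \<Rightarrow> real" where
  "graph_spectral_radius G = Max (spectrum (adjacency_matrix G))"

definition dissociation_set :: "'a pair_pre_digraph \<Rightarrow> 'a set \<Rightarrow> bool" where
  "dissociation_set G S \<longleftrightarrow>
     S \<subseteq> pverts G \<and> (\<forall>v\<in>S. out_degree (with_proj G \<restriction> S) v \<le> 1)"

definition dissociation_number :: "'a pair_pre_digraph \<Rightarrow> nat" where
  "dissociation_number G = Max (card ` {S. dissociation_set G S})"

definition connected_graphs :: "nat \<Rightarrow> nat \<Rightarrow> 'a pair_pre_digraph set" where
  "connected_graphs n k =
     {G. pair_graph G \<and> Digraph_Component.connected (with_proj G) \<and> card (pverts G) = n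
         \<and> dissociation_number G = k}"

definition complete_graph :: "'a set \<Rightarrow> 'a pair_pre_digraph" where
  "complete_graph V = \<lparr>pverts = V, parcs = {(u, v). u \<in> V \<and> v \<in> V \<and> u \<noteq> v}\<rparr>"

definition graph_join :: "'a pair_pre_digraph \<Rightarrow> 'a pair_pre_digraph \<Rightarrow> 'a pair_pre_digraph" where
  "graph_join G H =
     \<lparr>pverts = pverts G \<union> pverts H,
      parcs = parcs G \<union> parcs H \<union> pverts G \<times> pverts H \<union> pverts H \<times> pverts G\<rparr>"

text \<open>For even \<open>d\<close>, the removed edges \<open>{2k, 2k + 1}\<close> form a perfect matching of \<open>{0..<d}\<close>.\<close>
definition CP :: "nat \<Rightarrow> nat pair_pre_digraph" where
  "CP d = \<lparr>pverts = {0..<d}, parcs = parcs (complete_graph {0..<d}) - {(i, j). i div 2 = j div 2}\<rparr>"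

definition L :: "nat \<Rightarrow> nat pair_pre_digraph" where
  "L d = graph_join (CP (d - 1)) (complete_graph {d - 1})"

definition part :: "nat \<Rightarrow> nat pair_pre_digraph" where
  "part d = (if even d then CP d else L d)"

text \<open>
  The choice \<open>u = 0\<close>, \<open>v = 0\<close> is admissible by the lemma \<open>part_degree_0\<close> below. Any other vertices
  of degree \<open>n\<^sub>i - 2\<close> give an isomorphic graph, as the automorphisms of \<open>part d\<close> act transitively on
  the vertices of degree \<open>d - 2\<close>.
\<close>
definition T_hat :: "nat \<Rightarrow> (nat + nat) pair_pre_digraph" where
  "T_hat n =
     (let C1 = part (n div 2); C2 = part (n - n div 2)
      in \<lparr>pverts = pverts C1 <+> pverts C2,
          parcs = map_prod Inl Inl ` parcs C1 \<union> map_prod Inr Inr ` parcs C2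
                  \<union> {(Inl 0, Inr 0), (Inr 0, Inl 0)}\<rparr>)"

lemma out_degree_with_proj: "out_degree (with_proj G) v = card {w. (v, w) \<in> parcs G}"
proof -
  have "out_arcs (with_proj G) v = Pair v ` {w. (v, w) \<in> parcs G}"
    by (auto simp: out_arcs_def)
  then show ?thesis
    by (simp add: out_degree_def card_image inj_on_def)
qed

lemma part_degree_0:
  assumes "d \<ge> 3"
  shows "0 \<in> pverts (part d)" and "out_degree (with_proj (part d)) 0 = d - 2"
proof -
  show "0 \<in> pverts (part d)"
    using assms by (auto simp: part_def CP_def L_def graph_join_def complete_graph_def)
  have "{w. (0, w) \<in> parcs (part d)} = {2..<d}"
    using assms
    by (auto simp: part_def CP_def L_def graph_join_def complete_graph_def div_eq_0_iff)
  then show "out_degree (with_proj (part d)) 0 = d - 2"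
    by (simp add: out_degree_with_proj)
qed

end

theory Submission
  imports Defs "HOL-Analysis.Function_Topology" "HOL-Analysis.Convex"
begin

text \<open>
  A wheel (a vertex joined to a 4-cycle) in the complement \<open>H\<close> of \<open>G\<close> is a dissociation set of size 5
  of \<open>G\<close>, so the task is a Turan-type problem for wheels, here with \<open>n = 4k\<close>. Removing a \<open>K\<^sub>4\<close> of \<open>H\<close>, to
  which every other vertex sends at most two edges, shows that \<open>H\<close> has at most \<open>4k\<^sup>2 + 2k\<close> edges;
  if there is no \<open>K\<^sub>4\<close>, one removes \<open>K\<^sub>4\<close> minus an edge instead, and if there is no such subgraph
  either, adjacent vertices have at most one common neighbour and \<open>H\<close> has few edges. If at most one
  edge is missing from the bound, the same induction splits the vertices into two parts on which
  \<open>H\<close> is a matching. Hence a connected \<open>G\<close> has either the edge number of \<open>T_hat\<close> and is isomorphic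
  to it, or at least one edge more; in the latter case its average degree, at least \<open>2k - 2 + 1/k\<close>,
  bounds the spectral radius from below, and an explicit positive vector \<open>p\<close> with \<open>A p < \<theta> p\<close>,
  \<open>\<theta> = 2k - 2 + 1/k\<close>, shows that \<open>T_hat\<close> lies strictly below that bound.
\<close>

section \<open>Graphs without a wheel\<close>

text \<open>The extremal \<open>H\<close> has two halves of size \<open>2 * k\<close>, all edges
  between them and a perfect matching in each. Its complement is disconnected, so the extremal case
  alone settles nothing: structure is needed one edge below the bound, where the complement of
  \<open>T_hat (4 * k)\<close> lies. Everything is accounted for by a deficit, the bound
  \<open>8 * k\<^sup>2 + 4 * k\<close> minus the number of arcs. Removing a \<open>K4\<close> never
  increases the deficit, so near-extremality is inherited by the remaining vertices, whereas each
  removed diamond (\<open>K4\<close> minus an edge) costs two further arcs.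

  The obstacle is that a deficit of 2 leaves room for one irregularity: a missing edge between the
  halves, two unmatched vertices, or, during the induction, a vertex that sends a single edge to the
  clique. Each has to be shown to exclude the others.

  Arc counts are even, so a deficit above 2 is at least 4. Then \<open>G\<close> has at least
  \<open>8 * k\<^sup>2 - 8 * k + 4\<close> arcs, and division by \<open>4 * k\<close> gives
  \<theta>.\<close>

locale wheel_free =
  fixes h :: "'a \<Rightarrow> 'a \<Rightarrow> bool"
  assumes sym: "h x y \<Longrightarrow> h y x"
    and irrefl: "\<not> h x x"
    and no_wheel: "\<lbrakk>h c x1; h c x2; h c x3; h c x4; h x1 x2; h x2 x3; h x3 x4; h x4 x1; x1 \<noteq> x3; x2 \<noteq> x4\<rbrakk> \<Longrightarrow> False"
begin

section \<open>Degrees and arc counts\<close>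

lemma commute: "h x y \<longleftrightarrow> h y x"
  using sym by blast

definition deg :: "'a set \<Rightarrow> 'a \<Rightarrow> nat" where
  "deg V x = (\<Sum>y\<in>V. of_bool (h x y))"

text \<open>Ordered pairs are counted, so this is twice the number of edges inside \<open>V\<close>.\<close>
definition arcs :: "'a set \<Rightarrow> nat" where
  "arcs V = (\<Sum>x\<in>V. deg V x)"

lemma deg_eq_card: "finite V \<Longrightarrow> deg V x = card {y \<in> V. h x y}"
  by (simp add: deg_def Int_def)

lemma deg_Un: "finite A \<Longrightarrow> finite B \<Longrightarrow> A \<inter> B = {} \<Longrightarrow> deg (A \<union> B) x = deg A x + deg B x"
  unfolding deg_def by (rule sum.union_disjoint)

lemma deg_swap: "(\<Sum>x\<in>A. deg B x) = (\<Sum>x\<in>B. deg A x)"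
  unfolding deg_def by (subst sum.swap) (simp add: commute)

lemma arcs_Un:
  assumes "finite A" "finite B" "A \<inter> B = {}"
  shows "arcs (A \<union> B) = arcs A + arcs B + 2 * (\<Sum>x\<in>A. deg B x)"
  using assms deg_swap[of A B]
  by (simp add: arcs_def sum.union_disjoint deg_Un sum.distrib)

lemma arcs_remove:
  assumes "finite V" "T \<subseteq> V"
  shows "arcs V = arcs (V - T) + arcs T + 2 * (\<Sum>x\<in>V - T. deg T x)"
proof -
  have "V = (V - T) \<union> T" using assms by auto
  then show ?thesis
    using arcs_Un[of "V - T" T] assms finite_subset[of T V] by auto
qed

text \<open>Handshake parity. It raises a deficit above 2 to at least 4 and rules out halves of odd
  size.\<close>

lemma even_arcs: "finite V \<Longrightarrow> even (arcs V)"
proof (induction V rule: finite_induct)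
  case empty
  then show ?case by (simp add: arcs_def)
next
  case (insert x F)
  have "arcs (insert x F) = arcs F + 2 * deg F x"
    using arcs_Un[of "{x}" F] insert by (simp add: arcs_def deg_def irrefl)
  then show ?case using insert by simp
qed

section \<open>Removing a \<open>K4\<close> or a diamond: the upper bound\<close>

definition K4 :: "'a \<Rightarrow> 'a \<Rightarrow> 'a \<Rightarrow> 'a \<Rightarrow> bool" where
  "K4 a b c d \<longleftrightarrow> h a b \<and> h a c \<and> h a d \<and> h b c \<and> h b d \<and> h c d"

definition K4_free :: "'a set \<Rightarrow> bool" where
  "K4_free V \<longleftrightarrow> \<not> (\<exists>a\<in>V. \<exists>b\<in>V. \<exists>c\<in>V. \<exists>d\<in>V. K4 a b c d)"

lemma K4_distinct: "K4 a b c d \<Longrightarrow> distinct [a, b, c, d]"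
  using irrefl by (auto simp: K4_def)

lemma deg_four: "distinct [a, b, c, d] \<Longrightarrow>
    deg {a, b, c, d} x = of_bool (h x a) + of_bool (h x b) + of_bool (h x c) + of_bool (h x d)"
  by (simp add: deg_def)

lemma K4_arcs: "K4 a b c d \<Longrightarrow> arcs {a, b, c, d} = 12"
  using K4_distinct[of a b c d] irrefl
  by (simp add: arcs_def deg_four K4_def commute)

text \<open>Three neighbours \<open>p\<close>, \<open>q\<close>, \<open>r\<close> of
  \<open>x\<close> in the clique, with \<open>s\<close> the fourth clique vertex, would give the
  4-cycle \<open>q\<close>, \<open>x\<close>, \<open>r\<close>, \<open>s\<close> around the hub
  \<open>p\<close>.\<close>

lemma K4_deg:
  assumes "K4 a b c d" "x \<notin> {a, b, c, d}"
  shows "deg {a, b, c, d} x \<le> 2"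
proof -
  have d: "distinct [a, b, c, d]" using K4_distinct assms by blast
  have *: False if "h x p" "h x q" "h x r" "h p q" "h p r" "h p s" "h q s" "h r s" "q \<noteq> r" "x \<noteq> s" for p q r s
    using no_wheel[of p q x r s] that sym by blast
  have "\<not> (h x a \<and> h x b \<and> h x c)" "\<not> (h x a \<and> h x b \<and> h x d)"
    "\<not> (h x a \<and> h x c \<and> h x d)" "\<not> (h x b \<and> h x c \<and> h x d)"
    using *[of a b c d] *[of a b d c] *[of a c d b] *[of b c d a] assms d by (auto simp: K4_def commute)
  then show ?thesis unfolding deg_four[OF d] by (auto simp: of_bool_def)
qed

text \<open>Every edge between the four vertices and the rest counts as two arcs, so there are at
  most \<open>4 * (card V - 4)\<close> such arcs. The 16 stands on the left to avoid truncated
  subtraction.\<close>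

lemma arcs_remove_four:
  assumes V: "finite V" "{a, b, c, d} \<subseteq> V" "distinct [a, b, c, d]"
    and le: "\<And>x. x \<in> V - {a, b, c, d} \<Longrightarrow> deg {a, b, c, d} x \<le> 2"
  shows "arcs V + 16 \<le> arcs (V - {a, b, c, d}) + arcs {a, b, c, d} + 4 * card V"
    and "card (V - {a, b, c, d}) + 4 = card V"
proof -
  have "card {a, b, c, d} = 4" using V(3) by simp
  moreover have "card {a, b, c, d} \<le> card V" by (intro card_mono V)
  ultimately show c: "card (V - {a, b, c, d}) + 4 = card V"
    using V by (simp add: card_Diff_subset)
  have "(\<Sum>x\<in>V - {a, b, c, d}. deg {a, b, c, d} x) \<le> card (V - {a, b, c, d}) * 2"
    using sum_bounded_above[of "V - {a, b, c, d}" "deg {a, b, c, d}" 2] le by simp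
  then show "arcs V + 16 \<le> arcs (V - {a, b, c, d}) + arcs {a, b, c, d} + 4 * card V"
    unfolding arcs_remove[OF V(1,2)] using c by linarith
qed

text \<open>Adjacent vertices share at most one neighbour, so their degrees add up to at most
  \<open>card V + 1\<close>. Summing this over all arcs bounds twice the sum of the squared degrees,
  and Cauchy-Schwarz leads back to \<open>arcs V\<close>.\<close>

lemma arcs_diamond_free:
  assumes V: "finite V"
    and free: "\<not> (\<exists>a\<in>V. \<exists>b\<in>V. \<exists>c\<in>V. \<exists>d\<in>V. c \<noteq> d \<and> h a b \<and> h a c \<and> h a d \<and> h b c \<and> h b d)"
  shows "2 * arcs V \<le> card V * (card V + 1)"
proof -
  let ?n = "card V"
  have edge: "deg V u + deg V v \<le> ?n + 1" if "u \<in> V" "v \<in> V" "h u v" for u v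
  proof -
    let ?I = "{y \<in> V. h u y} \<inter> {y \<in> V. h v y}"
    have "card ?I \<le> Suc 0"
      using V free that by (subst card_le_Suc0_iff_eq) auto
    moreover have "card ({y \<in> V. h u y} \<union> {y \<in> V. h v y}) \<le> ?n"
      by (intro card_mono V) auto
    ultimately show ?thesis
      using card_Un_Int[of "{y \<in> V. h u y}" "{y \<in> V. h v y}"] V by (simp add: deg_eq_card)
  qed
  have "(\<Sum>u\<in>V. \<Sum>v\<in>V. of_bool (h u v) * (deg V u + deg V v)) \<le> (\<Sum>u\<in>V. \<Sum>v\<in>V. of_bool (h u v) * (?n + 1))"
    using edge by (intro sum_mono) auto
  also have "\<dots> = arcs V * (?n + 1)"
    unfolding arcs_def deg_def by (simp only: sum_distrib_right)
  finally have 1: "(\<Sum>u\<in>V. \<Sum>v\<in>V. of_bool (h u v) * (deg V u + deg V v)) \<le> arcs V * (?n + 1)" .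
  have a: "(\<Sum>u\<in>V. \<Sum>v\<in>V. of_bool (h u v) * deg V u) = (\<Sum>u\<in>V. (deg V u)\<^sup>2)"
    by (simp add: deg_def power2_eq_square sum_distrib_right)
  have "(\<Sum>u\<in>V. \<Sum>v\<in>V. of_bool (h u v) * deg V v) = (\<Sum>v\<in>V. \<Sum>u\<in>V. of_bool (h u v) * deg V v)"
    by (rule sum.swap)
  also have "\<dots> = (\<Sum>u\<in>V. (deg V u)\<^sup>2)"
    unfolding a[symmetric] by (simp add: commute)
  finally have "2 * (\<Sum>u\<in>V. (deg V u)\<^sup>2) \<le> arcs V * (?n + 1)"
    using 1 a by (simp add: distrib_left sum.distrib)
  moreover have "(arcs V)\<^sup>2 \<le> (\<Sum>u\<in>V. (deg V u)\<^sup>2) * ?n"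
  proof -
    have "(\<Sum>u\<in>V. real (deg V u))\<^sup>2 \<le> (\<Sum>u\<in>V. (real (deg V u))\<^sup>2) * ?n"
      by (rule sum_squared_le_sum_of_squares)
    then have "real ((arcs V)\<^sup>2) \<le> real ((\<Sum>u\<in>V. (deg V u)\<^sup>2) * ?n)"
      by (simp add: arcs_def)
    then show ?thesis by linarith
  qed
  ultimately have "arcs V * (2 * arcs V) \<le> arcs V * (?n * (?n + 1))"
    using mult_le_mono1[of "2 * (\<Sum>u\<in>V. (deg V u)\<^sup>2)" "arcs V * (?n + 1)" ?n]
    by (simp add: power2_eq_square algebra_simps)
  then show ?thesis by (cases "arcs V = 0") auto
qed

lemma diamond_distinct:
  assumes "c \<noteq> d" "h a b" "h a c" "h a d" "h b c" "h b d"
  shows "distinct [a, b, c, d]"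
  using assms irrefl by auto

lemma diamond_arcs:
  assumes "K4_free V" "{a, b, c, d} \<subseteq> V"
    and h: "c \<noteq> d" "h a b" "h a c" "h a d" "h b c" "h b d"
  shows "arcs {a, b, c, d} = 10"
proof -
  have "\<not> h c d" using assms unfolding K4_free_def K4_def by auto
  then show ?thesis
    using diamond_distinct[OF h] h irrefl by (simp add: arcs_def deg_four commute)
qed

text \<open>Adjacency to \<open>a\<close>, \<open>b\<close> and one of \<open>c\<close>,
  \<open>d\<close> would create a \<open>K4\<close>. Adjacency to \<open>c\<close>, \<open>d\<close>
  and one of \<open>a\<close>, \<open>b\<close> would create a wheel whose hub is that last vertex.
  These are all the triples.\<close>

lemma diamond_deg:
  assumes "K4_free V" "{a, b, c, d} \<subseteq> V"
    and h: "c \<noteq> d" "h a b" "h a c" "h a d" "h b c" "h b d"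
    and x: "x \<in> V - {a, b, c, d}"
  shows "deg {a, b, c, d} x \<le> 2"
proof -
  have "\<not> K4 a b c x" "\<not> K4 a b d x" using assms(1,2) x unfolding K4_free_def by auto
  then have "\<not> (h x a \<and> h x b \<and> h x c)" "\<not> (h x a \<and> h x b \<and> h x d)"
    using h by (auto simp: K4_def commute)
  moreover have "\<not> (h x a \<and> h x c \<and> h x d)" "\<not> (h x b \<and> h x c \<and> h x d)"
    using no_wheel[of a b c x d] no_wheel[of b a c x d] h x by (auto simp: commute)
  ultimately show ?thesis
    unfolding deg_four[OF diamond_distinct[OF h]] by (auto simp: of_bool_def)
qed

lemma K4_free_subset: "K4_free V \<Longrightarrow> W \<subseteq> V \<Longrightarrow> K4_free W"
  unfolding K4_free_def by blast

text \<open>A diamond has 10 arcs where a \<open>K4\<close> has 12, so each removal adds at least 2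
  to the deficit; if there is no diamond, the deficit is already at least \<open>2 * k\<close>. The
  deficit 4 for \<open>k \<ge> 2\<close> forces a \<open>K4\<close> into every near-extremal set,
  while the weaker 2 is what the induction passes on.\<close>

lemma arcs_K4_free:
  assumes "finite V" "card V = 4 * k" "k \<ge> 1" "K4_free V"
  shows "arcs V + 2 \<le> 8 * k\<^sup>2 + 4 * k \<and> (k \<ge> 2 \<longrightarrow> arcs V + 4 \<le> 8 * k\<^sup>2 + 4 * k)"
  using assms
proof (induction k arbitrary: V)
  case 0
  then show ?case by simp
next
  case (Suc k V)
  note fin = Suc.prems(1) and card = Suc.prems(2) and free = Suc.prems(4)
  show ?case
  proof (cases "\<exists>a\<in>V. \<exists>b\<in>V. \<exists>c\<in>V. \<exists>d\<in>V. c \<noteq> d \<and> h a b \<and> h a c \<and> h a d \<and> h b c \<and> h b d")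
    case False
    have "2 * arcs V \<le> 4 * Suc k * (4 * Suc k + 1)"
      using arcs_diamond_free[OF fin False] card by simp
    then have "arcs V \<le> 8 * (Suc k)\<^sup>2 + 2 * Suc k"
      by (simp add: power2_eq_square algebra_simps)
    then show ?thesis by (auto simp: algebra_simps)
  next
    case True
    then obtain a b c d where abcd: "{a, b, c, d} \<subseteq> V"
      and h: "c \<noteq> d" "h a b" "h a c" "h a d" "h b c" "h b d" by blast
    note dist = diamond_distinct[OF h] and ten = diamond_arcs[OF free abcd h]
    have le: "deg {a, b, c, d} x \<le> 2" if "x \<in> V - {a, b, c, d}" for x
      using diamond_deg[OF free abcd h] that by blast
    note rem = arcs_remove_four[OF fin abcd dist le]
    show ?thesis
    proof (cases "k = 0")
      case True
      then have "V - {a, b, c, d} = {}" using rem(2) card fin by simp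
      then have "arcs (V - {a, b, c, d}) = 0" by (simp only: arcs_def sum.empty)
      then show ?thesis using rem(1) ten card True by simp
    next
      case False
      have "arcs (V - {a, b, c, d}) + 2 \<le> 8 * k\<^sup>2 + 4 * k"
        using Suc.IH[of "V - {a, b, c, d}"] fin rem(2) card False K4_free_subset[OF free] by auto
      then show ?thesis using rem(1) ten card by (simp add: power2_eq_square algebra_simps)
    qed
  qed
qed

lemma arcs_remove_K4:
  assumes V: "finite V" "{a, b, c, d} \<subseteq> V" and K: "K4 a b c d"
  shows "arcs V + 4 \<le> arcs (V - {a, b, c, d}) + 4 * card V"
    and "card (V - {a, b, c, d}) + 4 = card V"
  using arcs_remove_four[OF V K4_distinct[OF K]] K4_deg[OF K] K4_arcs[OF K] by fastforce+

theorem arcs_upper_bound: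
  assumes "finite V" "card V = 4 * k"
  shows "arcs V \<le> 8 * k\<^sup>2 + 4 * k"
  using assms
proof (induction k arbitrary: V)
  case 0
  then show ?case by (simp add: arcs_def)
next
  case (Suc k V)
  show ?case
  proof (cases "K4_free V")
    case True
    then show ?thesis using arcs_K4_free[of V "Suc k"] Suc.prems by simp
  next
    case False
    then obtain a b c d where abcd: "{a, b, c, d} \<subseteq> V" and K: "K4 a b c d"
      unfolding K4_free_def by blast
    \<comment> \<open>The gain \<open>16 * (k + 1) - 4\<close> is exactly the growth of the bound
      from \<open>k\<close> to \<open>k + 1\<close>.\<close>
    note rem = arcs_remove_K4[OF Suc.prems(1) abcd K]
    have "arcs (V - {a, b, c, d}) \<le> 8 * k\<^sup>2 + 4 * k"
      using Suc rem(2) by simp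
    then show ?thesis using rem(1) Suc.prems by (simp add: power2_eq_square algebra_simps)
  qed
qed

section \<open>Partitions into two matchings near the bound\<close>

definition matching :: "'a set \<Rightarrow> bool" where
  "matching A \<longleftrightarrow> (\<forall>x\<in>A. \<forall>y\<in>A. \<forall>z\<in>A. h x y \<longrightarrow> h x z \<longrightarrow> y = z)"

lemma matchingD: "matching A \<Longrightarrow> h x y \<Longrightarrow> h x z \<Longrightarrow> x \<in> A \<Longrightarrow> y \<in> A \<Longrightarrow> z \<in> A \<Longrightarrow> y = z"
  unfolding matching_def by blast

lemma matching_arcs:
  assumes "finite A" "matching A"
  shows "arcs A + card {a \<in> A. \<forall>y\<in>A. \<not> h a y} = card A"
proof -
  have "deg A a = of_bool (\<exists>y\<in>A. h a y)" if "a \<in> A" for a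
  proof (cases "\<exists>y\<in>A. h a y")
    case True
    then obtain y where "y \<in> A" "h a y" by blast
    then have "{z \<in> A. h a z} = {y}" using matchingD[OF assms(2)] that by blast
    then show ?thesis using True by (simp add: deg_eq_card[OF assms(1)])
  qed (simp add: deg_def)
  then have "arcs A = card {a \<in> A. \<exists>y\<in>A. h a y}"
    using assms(1) by (simp add: arcs_def Int_def)
  moreover have "card A = card ({a \<in> A. \<exists>y\<in>A. h a y} \<union> {a \<in> A. \<forall>y\<in>A. \<not> h a y})"
    by (rule arg_cong[of _ _ card]) auto
  ultimately show ?thesis using assms(1) by (subst (asm) card_Un_disjoint) auto
qed

lemma cross_arcs:
  assumes "finite A" "finite B"
  shows "(\<Sum>x\<in>A. deg B x) + card {(a, b) \<in> A \<times> B. \<not> h a b} = card A * card B"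
proof -
  have "(\<Sum>x\<in>A. deg B x) = (\<Sum>p\<in>A \<times> B. of_bool (h (fst p) (snd p)))"
    by (simp add: deg_def sum.cartesian_product case_prod_beta del: sum_of_bool_eq)
  also have "\<dots> = card {p \<in> A \<times> B. h (fst p) (snd p)}"
    using assms by (simp add: Int_def)
  finally have sum: "(\<Sum>x\<in>A. deg B x) = card {p \<in> A \<times> B. h (fst p) (snd p)}" .
  have split: "A \<times> B = {p \<in> A \<times> B. h (fst p) (snd p)} \<union> {(a, b) \<in> A \<times> B. \<not> h a b}" (is "_ = ?P \<union> ?Q")
    by auto
  have "finite (A \<times> B)" using assms by simp
  then have "finite ?P" "finite ?Q" by (rule finite_subset[rotated], blast)+
  then have "card (?P \<union> ?Q) = card ?P + card ?Q"
    by (intro card_Un_disjoint) auto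
  then show ?thesis unfolding sum split[symmetric] card_cartesian_product by simp
qed

text \<open>The \<open>+ 2\<close> admits a deficit of one edge. Since \<open>matching\<close>
  allows unmatched vertices, neither perfect matchings nor equal halves are built in; they are
  derived from the arc count.\<close>

definition near_extremal :: "nat \<Rightarrow> 'a set \<Rightarrow> 'a set \<Rightarrow> bool" where
  "near_extremal k A B \<longleftrightarrow> finite A \<and> finite B \<and> A \<inter> B = {} \<and> matching A \<and> matching B \<and>
     card (A \<union> B) = 4 * k \<and> arcs (A \<union> B) + 2 \<ge> 8 * k\<^sup>2 + 4 * k"

lemma near_extremal_sym: "near_extremal k A B \<Longrightarrow> near_extremal k B A"
  by (auto simp: near_extremal_def Un_commute Int_commute)

text \<open>The arcs amount to \<open>2 * (card A * card B) + 4 * k\<close> minus the losses from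
  missing cross pairs and unmatched vertices. With sizes \<open>2 * k + j\<close> and
  \<open>2 * k - j\<close> the product term loses \<open>2 * j\<^sup>2\<close>, so a deficit of at
  most 2 leaves only \<open>j\<close> in {-1, 0, 1}, and parity excludes the nonzero values.\<close>

lemma near_extremal_count:
  assumes "near_extremal k A B"
  shows "card A = 2 * k" "card B = 2 * k"
    and "arcs (A \<union> B) + 2 * card {(a, b) \<in> A \<times> B. \<not> h a b}
          + card {a \<in> A. \<forall>y\<in>A. \<not> h a y} + card {b \<in> B. \<forall>y\<in>B. \<not> h b y} = 8 * k\<^sup>2 + 4 * k"
proof -
  have fin: "finite A" "finite B" and disj: "A \<inter> B = {}" and "matching A" "matching B"
    and card: "card (A \<union> B) = 4 * k" and arcs: "arcs (A \<union> B) + 2 \<ge> 8 * k\<^sup>2 + 4 * k"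
    using assms by (auto simp: near_extremal_def)
  note A = matching_arcs[OF fin(1) \<open>matching A\<close>] and B = matching_arcs[OF fin(2) \<open>matching B\<close>]
  have sum: "card A + card B = 4 * k" using card card_Un_disjoint[OF fin disj] by simp
  note cross = cross_arcs[OF fin]
  have total: "arcs (A \<union> B) + 2 * card {(a, b) \<in> A \<times> B. \<not> h a b}
          + card {a \<in> A. \<forall>y\<in>A. \<not> h a y} + card {b \<in> B. \<forall>y\<in>B. \<not> h b y} = 2 * (card A * card B) + 4 * k"
    using arcs_Un[OF fin disj] A B cross sum by linarith
  define j where "j = int (card A) - 2 * int k"
  have j: "int (card A) = 2 * int k + j" "int (card B) = 2 * int k - j"
    using sum by (auto simp: j_def)
  have prod: "2 * int (card A * card B) = 8 * (int k)\<^sup>2 - 2 * j\<^sup>2"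
    unfolding of_nat_mult j by (simp add: power2_eq_square algebra_simps)
  have arcs': "8 * (int k)\<^sup>2 + 4 * int k \<le> int (arcs (A \<union> B)) + 2"
    using arcs by (metis (mono_tags, lifting) of_nat_add of_nat_le_iff of_nat_mult of_nat_numeral of_nat_power)
  have bound: "int (arcs (A \<union> B)) + int (card {a \<in> A. \<forall>y\<in>A. \<not> h a y}) + int (card {b \<in> B. \<forall>y\<in>B. \<not> h b y})
     \<le> 2 * int (card A * card B) + 4 * int k"
    using total by linarith
  have "j = 0"
  proof (rule ccontr)
    assume "j \<noteq> 0"
    have pos: "n \<ge> 1" if "odd n" for n :: nat using that by (cases n) auto
    have "j\<^sup>2 \<le> 1" using arcs' bound prod by linarith
    moreover have "j\<^sup>2 \<ge> 1" using \<open>j \<noteq> 0\<close> by (metis int_one_le_iff_zero_less zero_less_power2)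
    ultimately have "j\<^sup>2 = 1" by simp
    then have "\<bar>j\<bar> = 1" by (simp add: power2_eq_1_iff) auto
    \<comment> \<open>Now both halves have odd size, so each leaves a vertex unmatched, and the
      deficit is at least \<open>2 + 1 + 1\<close>.\<close>
    then have "odd j" by (cases "j \<ge> 0") auto
    then have "odd (int (card A))" "odd (int (card B))" unfolding j by auto
    then have "odd (arcs A + card {a \<in> A. \<forall>y\<in>A. \<not> h a y})" "odd (arcs B + card {b \<in> B. \<forall>y\<in>B. \<not> h b y})"
      unfolding A B by simp_all
    then have "odd (card {a \<in> A. \<forall>y\<in>A. \<not> h a y})" "odd (card {b \<in> B. \<forall>y\<in>B. \<not> h b y})"
      using even_arcs[OF fin(1)] even_arcs[OF fin(2)] by (simp_all only: even_add simp_thms)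
    then have "card {a \<in> A. \<forall>y\<in>A. \<not> h a y} \<ge> 1" "card {b \<in> B. \<forall>y\<in>B. \<not> h b y} \<ge> 1"
      by (blast intro: pos)+
    then show False using arcs' bound prod \<open>j\<^sup>2 = 1\<close> by linarith
  qed
  then show c: "card A = 2 * k" "card B = 2 * k" using j by auto
  show "arcs (A \<union> B) + 2 * card {(a, b) \<in> A \<times> B. \<not> h a b}
          + card {a \<in> A. \<forall>y\<in>A. \<not> h a y} + card {b \<in> B. \<forall>y\<in>B. \<not> h b y} = 8 * k\<^sup>2 + 4 * k"
    using total unfolding c by (simp add: power2_eq_square)
qed

lemma near_extremal_finite:
  assumes "near_extremal k A B"
  shows "finite {(a, b) \<in> A \<times> B. \<not> h a b}" "finite {a \<in> A. \<forall>y\<in>A. \<not> h a y}" "finite {b \<in> B. \<forall>y\<in>B. \<not> h b y}"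
proof -
  have "finite A" "finite B" using assms by (auto simp: near_extremal_def)
  then show "finite {a \<in> A. \<forall>y\<in>A. \<not> h a y}" "finite {b \<in> B. \<forall>y\<in>B. \<not> h b y}"
    by simp_all
  show "finite {(a, b) \<in> A \<times> B. \<not> h a b}"
    by (rule finite_subset[of _ "A \<times> B"]) (use \<open>finite A\<close> \<open>finite B\<close> in auto)
qed

text \<open>A missing cross pair costs two arcs, which is the whole allowance.\<close>

lemma near_extremal_one_missing:
  assumes ext: "near_extremal k A B" and "a \<in> A" "b \<in> B" "\<not> h a b" "a' \<in> A" "b' \<in> B" "\<not> h a' b'"
  shows "a' = a \<and> b' = b"
proof -
  have "2 * card {(a, b) \<in> A \<times> B. \<not> h a b} \<le> 2"
    using near_extremal_count(3)[OF ext] ext unfolding near_extremal_def by linarith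
  then have "card {(a, b) \<in> A \<times> B. \<not> h a b} \<le> Suc 0" by simp
  then have "(a', b') = (a, b)"
    using assms unfolding card_le_Suc0_iff_eq[OF near_extremal_finite(1)[OF ext]] by blast
  then show ?thesis by simp
qed

text \<open>The missing cross pair has used up the deficit, so no unmatched vertex can be
  afforded.\<close>

lemma near_extremal_partner:
  assumes ext: "near_extremal k A B" and ab: "a \<in> A" "b \<in> B" "\<not> h a b" and "x \<in> A"
  shows "\<exists>y\<in>A. h x y"
proof -
  have "{(a, b) \<in> A \<times> B. \<not> h a b} \<noteq> {}" using ab by auto
  then have "card {(a, b) \<in> A \<times> B. \<not> h a b} \<ge> 1"
    using near_extremal_finite(1)[OF ext] by (simp add: Suc_le_eq card_gt_0_iff)
  then have "card {a \<in> A. \<forall>y\<in>A. \<not> h a y} = 0"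
    using near_extremal_count(3)[OF ext] ext unfolding near_extremal_def by linarith
  then have "{a \<in> A. \<forall>y\<in>A. \<not> h a y} = {}"
    using near_extremal_finite(2)[OF ext] card_0_eq by blast
  then show ?thesis using \<open>x \<in> A\<close> by blast
qed

lemma extremal_complete:
  assumes ext: "near_extremal k A B" and "arcs (A \<union> B) \<ge> 8 * k\<^sup>2 + 4 * k"
  shows "\<And>a b. a \<in> A \<Longrightarrow> b \<in> B \<Longrightarrow> h a b" "\<And>x. x \<in> A \<Longrightarrow> \<exists>y\<in>A. h x y"
proof -
  have "card {(a, b) \<in> A \<times> B. \<not> h a b} = 0"
    using near_extremal_count(3)[OF ext] assms(2) by linarith
  moreover have "card {a \<in> A. \<forall>y\<in>A. \<not> h a y} = 0"
    using near_extremal_count(3)[OF ext] assms(2) by linarith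
  ultimately have e: "{(a, b) \<in> A \<times> B. \<not> h a b} = {}" "{a \<in> A. \<forall>y\<in>A. \<not> h a y} = {}"
    using near_extremal_finite[OF ext] by simp_all
  show "h a b" if "a \<in> A" "b \<in> B" for a b using e(1) that by blast
  show "\<exists>y\<in>A. h x y" if "x \<in> A" for x using e(2) that by blast
qed

text \<open>Otherwise \<open>t\<close>, \<open>y\<close>, \<open>x\<close>, \<open>z\<close> is a
  4-cycle around the hub \<open>s\<close>. In this form wheel-freeness applies to the common
  neighbours of an edge \<open>st\<close>.\<close>

lemma fan:
  assumes "h s t" "h s x" "h s y" "h s z" "h t y" "h t z" "h x y" "h x z" "t \<noteq> x"
  shows "y = z"
proof (rule ccontr)
  assume "y \<noteq> z"
  then show False
    using no_wheel[OF assms(1,3,2,4,5) sym[OF assms(7)] assms(8) sym[OF assms(6)]] assms(9) by blast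
qed

text \<open>
  Near the bound, one vertex \<open>w\<close> may send a single edge \<open>wt\<close> to the removed clique. The rest of the
  graph is then extremal, with parts \<open>X\<close> and \<open>Y\<close>, and \<open>w\<close> can be added to the class \<open>C\<close> of the common
  neighbours of \<open>s\<close> and \<open>t\<close>.
\<close>
lemma exceptional_class:
  assumes XY: "matching X" "matching Y" "card X = card Y" "finite X" "finite Y"
    and full: "\<And>x y. x \<in> X \<Longrightarrow> y \<in> Y \<Longrightarrow> h x y"
      "\<And>x. x \<in> X \<Longrightarrow> \<exists>y\<in>X. h x y" "\<And>x. x \<in> Y \<Longrightarrow> \<exists>y\<in>Y. h x y"
    and st: "h s t" "h t w" "s \<noteq> w" and w: "w \<in> X"
    and CD: "matching C" "matching D" "C \<union> D = X \<union> Y - {w}" "\<And>x. x \<in> C \<Longrightarrow> h s x \<and> h t x"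
  shows "matching (insert w C)"
proof -
  \<comment> \<open>Here \<open>t\<close> is the hub: two neighbours of \<open>w\<close> in
    \<open>C\<close> would close the cycle \<open>s\<close>, \<open>y\<close>, \<open>w\<close>,
    \<open>z\<close>.\<close>
  have one: "y = z" if "y \<in> C" "z \<in> C" "h w y" "h w z" for y z
    using fan[of t s w y z] st(2,3) sym[OF st(1)] CD(4)[OF that(1)] CD(4)[OF that(2)] that(3,4) sym by blast
  \<comment> \<open>A path \<open>w\<close>, \<open>x\<close>, \<open>z\<close> with
    \<open>x\<close>, \<open>z\<close> in \<open>C\<close> forces \<open>z\<close> into
    \<open>X\<close> and \<open>x\<close> into \<open>Y\<close>. The partner \<open>w'\<close> of
    \<open>w\<close>, the partner \<open>x'\<close> of \<open>x\<close> and a third vertex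
    \<open>y\<close> of \<open>Y\<close> are then all excluded from \<open>C\<close>. So they lie in
    \<open>D\<close>, where \<open>w'\<close> has the two neighbours \<open>x'\<close> and
    \<open>y\<close>.\<close>
  have no: False if xz: "x \<in> C" "z \<in> C" and h: "h w x" "h x z" for x z
  proof -
    have xz': "x \<in> X \<union> Y" "z \<in> X \<union> Y" "x \<noteq> w" "z \<noteq> w" using xz CD(3) by auto
    have "x \<noteq> z" using h irrefl by auto
    then have "\<not> h w z" using one xz h by blast
    then have z: "z \<in> X" using full(1) w xz' by blast
    have x: "x \<in> Y" using matchingD[OF XY(1), of x w z] h z w xz' sym by blast
    obtain w' where w': "w' \<in> X" "h w w'" using full(2) w by blast
    obtain x' where x': "x' \<in> Y" "h x x'" using full(3) x by blast
    have "w' \<noteq> z" "w' \<noteq> w" "x' \<noteq> x" using w' x' \<open>\<not> h w z\<close> irrefl by auto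
    have "card {w, z, w'} \<le> card X" using w w' z XY by (intro card_mono) auto
    then have "card Y \<ge> 3" using \<open>w' \<noteq> z\<close> \<open>w' \<noteq> w\<close> xz'(4) XY(3) by auto
    then have "card {x, x'} < card Y" by (simp add: card_insert_if split: if_splits)
    then have "\<not> Y \<subseteq> {x, x'}" using card_mono[of "{x, x'}" Y] by auto
    then obtain y where y: "y \<in> Y" "y \<noteq> x" "y \<noteq> x'" by blast
    have "w' \<notin> C" using matchingD[OF CD(1), of x z w'] xz h full(1)[OF w'(1) x] \<open>w' \<noteq> z\<close> sym by blast
    moreover have "q \<notin> C" if "q \<in> Y" "q \<noteq> x" for q using one[of q x] xz h full(1)[OF w] that by blast
    moreover have "w \<notin> Y" using full(1)[of w w] w irrefl by blast
    ultimately have "w' \<in> D" "x' \<in> D" "y \<in> D"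
      using w' x' y CD(3) \<open>w' \<noteq> w\<close> \<open>x' \<noteq> x\<close> by blast+
    then show False using matchingD[OF CD(2), of w' x' y] full(1) w'(1) x'(1) y by blast
  qed
  show ?thesis
    unfolding matching_def
  proof (intro ballI impI)
    fix x y z
    assume "x \<in> insert w C" "y \<in> insert w C" "z \<in> insert w C" and h: "h x y" "h x z"
    then show "y = z"
      using one[of y z] no[of x z] no[of x y] matchingD[OF CD(1), of x y z] irrefl[of w] sym[of x w] by auto
  qed
qed

section \<open>Neighbourhoods in the removed clique\<close>

lemma card_two_insert:
  assumes "card S = 2" "t \<in> S"
  obtains p where "S = {t, p}" "p \<noteq> t"
proof -
  obtain u v where "S = {u, v}" "u \<noteq> v" using assms(1) by (auto simp: card_2_iff)
  then show thesis using assms(2) that[of u] that[of v] by (cases "t = u") (auto simp: insert_commute)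
qed

text \<open>If the pairs \<open>{t, p}\<close> and \<open>{t, q}\<close> met in \<open>t\<close>
  alone, then \<open>x\<close>, \<open>y\<close>, \<open>q\<close>, \<open>p\<close> would be a
  4-cycle around \<open>t\<close>. Along an edge the clique neighbourhood therefore stays or flips
  to its complement, so only two classes arise.\<close>

lemma clique_classes:
  assumes T: "\<And>s t. s \<in> T \<Longrightarrow> t \<in> T \<Longrightarrow> s \<noteq> t \<Longrightarrow> h s t" "card T = 4"
    and x: "card {t \<in> T. h x t} = 2" and y: "card {t \<in> T. h y t} = 2" and h: "h x y"
    and xy: "x \<notin> T" "y \<notin> T"
  shows "{t \<in> T. h y t} = {t \<in> T. h x t} \<or> {t \<in> T. h y t} = T - {t \<in> T. h x t}"
proof -
  have fin: "finite T" using T(2) by (metis card.infinite zero_neq_numeral)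
  let ?X = "{t \<in> T. h x t}" and ?Y = "{t \<in> T. h y t}"
  show ?thesis
  proof (cases "?X \<inter> ?Y = {}")
    case True
    then have "?Y \<subseteq> T - ?X" by auto
    moreover have "card (T - ?X) = 2" using T(2) x fin by (subst card_Diff_subset) auto
    ultimately have "?Y = T - ?X" using y fin by (intro card_subset_eq) auto
    then show ?thesis by blast
  next
    case False
    then obtain t where t: "t \<in> T" "h x t" "h y t" by auto
    obtain p where p: "?X = {t, p}" "p \<noteq> t" using card_two_insert[of ?X t] x t by auto
    obtain q where q: "?Y = {t, q}" "q \<noteq> t" using card_two_insert[of ?Y t] y t by auto
    have pq: "p \<in> T" "q \<in> T" "h x p" "h y q" using p q by auto
    have "p = q"
    proof (rule ccontr)
      assume "p \<noteq> q"
      then have "h t p" "h t q" "h p q" using T(1) t pq p q by auto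
      moreover have "x \<noteq> q" "y \<noteq> p" using pq xy by auto
      ultimately show False
        using no_wheel[OF sym[OF t(2)] sym[OF t(3)] _ _ h pq(4) _ sym[OF pq(3)]] sym[of p q] by blast
    qed
    then show ?thesis using p q by simp
  qed
qed

text \<open>By \<open>fan\<close> with hub \<open>s\<close>. This is why the vertices with a common
  clique neighbourhood fit into one half.\<close>

lemma class_matching:
  assumes st: "h s t" and C: "\<And>x. x \<in> C \<Longrightarrow> h x s \<and> h x t"
  shows "matching C"
  unfolding matching_def
proof (intro ballI impI)
  fix x y z
  assume "x \<in> C" "y \<in> C" "z \<in> C" "h x y" "h x z"
  moreover from this have "t \<noteq> x" using C irrefl by blast
  ultimately show "y = z"
    using fan[OF st sym[of x s] sym[of y s] sym[of z s] sym[of y t] sym[of z t]] C by blast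
qed

lemma matching_Un_pair:
  assumes "matching C" "card Q = 2" "\<And>x y. x \<in> C \<Longrightarrow> y \<in> Q \<Longrightarrow> \<not> h x y"
  shows "matching (C \<union> Q)"
proof -
  obtain p q where "Q = {p, q}" using assms(2) by (auto simp: card_2_iff)
  then have Q: "\<not> h p p" "\<not> h q q" "\<And>x. x \<in> C \<Longrightarrow> \<not> h x p \<and> \<not> h x q \<and> \<not> h p x \<and> \<not> h q x"
    using assms(3) irrefl by (auto simp: commute)
  show ?thesis
    unfolding matching_def \<open>Q = {p, q}\<close>
  proof (intro ballI impI)
    fix x y z
    assume "x \<in> C \<union> {p, q}" "y \<in> C \<union> {p, q}" "z \<in> C \<union> {p, q}" "h x y" "h x z"
    then show "y = z" using Q matchingD[OF assms(1), of x y z] by auto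
  qed
qed

text \<open>Connectedness of \<open>h\<close> on \<open>A \<union> B\<close>, phrased as the
  spreading of a predicate so that it applies directly to neighbourhood classes. At most one cross
  pair is missing and each half has at least two vertices, so a detour of three edges avoids the
  missing pair.\<close>

lemma near_extremal_link:
  assumes ext: "near_extremal k A B" and k: "k \<ge> 1"
    and step: "\<And>x y. x \<in> A \<union> B \<Longrightarrow> y \<in> A \<union> B \<Longrightarrow> h x y \<Longrightarrow> R x \<Longrightarrow> R y"
    and x: "x \<in> A" "R x" and y: "y \<in> A \<union> B"
  shows "R y"
proof -
  have card: "card A = 2 * k" "card B = 2 * k" using near_extremal_count[OF ext] by auto
  have "finite A" "finite B" using ext by (auto simp: near_extremal_def)
  have two: "\<exists>v\<in>A. v \<noteq> u" "\<exists>v\<in>B. v \<noteq> u" for u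
  proof -
    have "\<not> A \<subseteq> {u}" "\<not> B \<subseteq> {u}"
      using card_mono[of "{u}" A] card_mono[of "{u}" B] card k by auto
    then show "\<exists>v\<in>A. v \<noteq> u" "\<exists>v\<in>B. v \<noteq> u" by auto
  qed
  note miss = near_extremal_one_missing[OF ext]
  have B: "R b" if b: "b \<in> B" for b
  proof (cases "h x b")
    case True
    then show ?thesis using step[of x b] x b by auto
  next
    case False
    obtain b' where b': "b' \<in> B" "b' \<noteq> b" using two by blast
    obtain a' where a': "a' \<in> A" "a' \<noteq> x" using two by blast
    have "h x b'" "h a' b'" "h a' b" using miss[OF x(1) b False] a' b' x b by blast+
    then have "R b'" "R b' \<Longrightarrow> R a'" "R a' \<Longrightarrow> R b"
      using step[of x b'] step[OF _ _ sym, of b' a'] step[of a' b] x a' b b' by blast+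
    then show ?thesis by blast
  qed
  have "R a" if a: "a \<in> A" for a
  proof -
    obtain b where b: "b \<in> B" using two by blast
    obtain b' where b': "b' \<in> B" "b' \<noteq> b" using two by blast
    have "h a b \<or> h a b'" using miss[OF a b _ a b'(1)] b'(2) by blast
    then show ?thesis using step[OF _ _ sym, of b a] step[OF _ _ sym, of b' a] B b b'(1) a by blast
  qed
  then show ?thesis using B y by blast
qed

lemma card_clique_complement:
  assumes "card T = 4" "P \<subseteq> T" "card P = 2"
  shows "card (T - P) = 2"
proof -
  have "finite T" using assms(1) by (metis card.infinite zero_neq_numeral)
  then show ?thesis using assms by (simp add: card_Diff_subset finite_subset)
qed

text \<open>All cross pairs are adjacent, so the two classes spread from \<open>x0\<close> to
  \<open>Y\<close> and from \<open>b0\<close> back to \<open>X\<close>, bypassing \<open>w\<close>,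
  to which \<open>clique_classes\<close> does not apply. Each class is then united with the two
  clique vertices that it misses.\<close>

lemma extremal_exceptional_partition:
  assumes ext: "near_extremal k X Y" and k: "k \<ge> 1"
    and T: "\<And>s t. s \<in> T \<Longrightarrow> t \<in> T \<Longrightarrow> s \<noteq> t \<Longrightarrow> h s t" "card T = 4" "T \<inter> (X \<union> Y) = {}"
    and arcs: "arcs (X \<union> Y) \<ge> 8 * k\<^sup>2 + 4 * k"
    and w: "w \<in> X" "card {t \<in> T. h w t} = 1"
    and two: "\<And>x. x \<in> X \<union> Y - {w} \<Longrightarrow> card {t \<in> T. h x t} = 2"
  shows "\<exists>A B. A \<union> B = X \<union> Y \<union> T \<and> A \<inter> B = {} \<and> matching A \<and> matching B"
proof -
  let ?N = "\<lambda>x. {t \<in> T. h x t}"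
  have m: "matching X" "matching Y" and fin: "finite X" "finite Y" and XY: "X \<inter> Y = {}"
    using ext by (auto simp: near_extremal_def)
  have card: "card X = 2 * k" "card Y = 2 * k" using near_extremal_count[OF ext] by auto
  note full = extremal_complete[OF ext arcs]
  have full': "\<exists>y\<in>Y. h x y" if "x \<in> Y" for x
    using extremal_complete(2)[OF near_extremal_sym[OF ext]] arcs that by (simp add: Un_commute)
  have "\<not> X \<subseteq> {w}" "\<not> Y \<subseteq> {}" using card_mono[of "{w}" X] card_mono[of "{}" Y] card k by auto
  then obtain x0 b0 where x0: "x0 \<in> X" "x0 \<noteq> w" and b0: "b0 \<in> Y" by auto
  have wY: "w \<notin> Y" using w XY by auto
  have cl: "?N y = ?N x \<or> ?N y = T - ?N x"
    if "card (?N x) = 2" "card (?N y) = 2" "h x y" "x \<notin> T" "y \<notin> T" for x y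
    by (rule clique_classes[OF _ T(2) that]) (rule T(1))
  have clY: "?N b = ?N x0 \<or> ?N b = T - ?N x0" if "b \<in> Y" for b
  proof (rule cl)
    show "x0 \<notin> T" "b \<notin> T" using x0 that T(3) by blast+
    show "card (?N x0) = 2" "card (?N b) = 2" using x0 that wY by (blast intro: two)+
    show "h x0 b" by (rule full(1)[OF x0(1) that])
  qed
  have cls: "?N x = ?N x0 \<or> ?N x = T - ?N x0" if "x \<in> X \<union> Y - {w}" for x
  proof (cases "x \<in> Y")
    case False
    then have "x \<in> X" using that by blast
    then have h: "h b0 x" by (intro sym[OF full(1)] b0)
    have "b0 \<in> X \<union> Y - {w}" "x \<notin> T" "b0 \<notin> T" using b0 wY that T(3) by blast+
    then have "?N x = ?N b0 \<or> ?N x = T - ?N b0"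
      using cl[OF two two[OF that] h] by blast
    then show ?thesis using clY[OF b0] by auto
  qed (use clY in blast)
  obtain t where t: "?N w = {t}" using w(2) by (auto simp: card_1_singleton_iff)
  \<comment> \<open>\<open>P\<close> is the class that contains the only clique neighbour
    \<open>t\<close> of \<open>w\<close>. Hence \<open>w\<close> has no neighbour in
    \<open>Q\<close> and can join the vertices of class \<open>P\<close>.\<close>
  define P where "P = (if t \<in> ?N x0 then ?N x0 else T - ?N x0)"
  define Q where "Q = T - P"
  have tT: "t \<in> T" "h w t" using t by auto
  have P: "t \<in> P" "P \<subseteq> T" using tT by (auto simp: P_def)
  have PQ: "?N x = P \<or> ?N x = Q" if "x \<in> X \<union> Y - {w}" for x
    using cls[OF that] by (auto simp: P_def Q_def)
  have "card (?N x0) = 2" using two[of x0] x0 by blast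
  then have cP: "card P = 2" using card_clique_complement[OF T(2), of "?N x0"] by (auto simp: P_def)
  then have cQ: "card Q = 2" using card_clique_complement[OF T(2) P(2)] by (simp add: Q_def)
  obtain s where s: "P = {t, s}" "s \<noteq> t" using card_two_insert[OF cP P(1)] by blast
  obtain p q where pq: "Q = {p, q}" "p \<noteq> q" using cQ by (auto simp: card_2_iff)
  have sT: "s \<in> T" "p \<in> T" "q \<in> T" using s P pq by (auto simp: Q_def)
  define C where "C = {x \<in> X \<union> Y - {w}. ?N x = P}"
  define D where "D = {x \<in> X \<union> Y - {w}. ?N x = Q}"
  have CD: "C \<union> D = X \<union> Y - {w}" "C \<inter> D = {}"
    using PQ P(1) by (auto simp: C_def D_def Q_def)
  have Cst': "h x s \<and> h x t" if "x \<in> C" for x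
    using that s(1) unfolding C_def by blast
  then have Cst: "h s x \<and> h t x" if "x \<in> C" for x
    using that sym by blast
  have Dpq: "h x p \<and> h x q" if "x \<in> D" for x
    using that pq(1) unfolding D_def by blast
  have mC: "matching C" by (rule class_matching[of s t]) (use T(1) sT tT s Cst' in blast)+
  have mD: "matching D" by (rule class_matching[of p q]) (use T(1) sT pq Dpq in blast)+
  have hst: "h s t" "s \<noteq> w" and XY': "card X = card Y" using T(1,3) sT(1) tT(1) s(2) w(1) card by auto
  have "matching (insert w C)"
    by (rule exceptional_class[OF m XY' fin full full' hst(1) sym[OF tT(2)] hst(2) w(1) mC mD CD(1) Cst])
  then have A: "matching (insert w C \<union> Q)"
  proof (rule matching_Un_pair[OF _ cQ])
    show "\<not> h x y" if xy: "x \<in> insert w C" "y \<in> Q" for x y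
    proof
      assume h: "h x y"
      have y: "y \<in> T" "y \<notin> P" using xy(2) by (auto simp: Q_def)
      have "y \<in> ?N x" using h y by simp
      then show False using xy(1) t y P(1) by (auto simp: C_def)
    qed
  qed
  have B: "matching (D \<union> P)"
  proof (rule matching_Un_pair[OF mD cP])
    show "\<not> h x y" if "x \<in> D" "y \<in> P" for x y
      using that P(2) unfolding D_def Q_def by blast
  qed
  have cover: "(insert w C \<union> Q) \<union> (D \<union> P) = X \<union> Y \<union> T" "(insert w C \<union> Q) \<inter> (D \<union> P) = {}"
  proof -
    have PQT: "P \<union> Q = T" "P \<inter> Q = {}" using P(2) by (auto simp: Q_def)
    have sub: "C \<union> D \<subseteq> X \<union> Y" "w \<notin> D" "w \<notin> T" using CD(1) w(1) T(3) by blast+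
    have "(insert w C \<union> Q) \<union> (D \<union> P) = insert w (C \<union> D) \<union> (P \<union> Q)" by blast
    also have "insert w (C \<union> D) = X \<union> Y" unfolding CD(1) using w(1) by blast
    finally show "(insert w C \<union> Q) \<union> (D \<union> P) = X \<union> Y \<union> T" unfolding PQT(1) .
    have "(C \<union> D) \<inter> T = {}" "P \<subseteq> T" "Q \<subseteq> T" using sub(1) T(3) PQT by blast+
    then show "(insert w C \<union> Q) \<inter> (D \<union> P) = {}" using sub(2,3) CD(2) PQT(2) by blast
  qed
  show ?thesis
  proof (rule exI, rule exI, rule conjI[OF cover(1) conjI[OF cover(2) conjI[OF A B]]])
  qed
qed

text \<open>The allowance may be spent inside \<open>X \<union> Y\<close> here, so a cross pair can
  be missing and the classes spread by \<open>near_extremal_link\<close> instead of complete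
  adjacency.\<close>

lemma near_extremal_regular_partition:
  assumes ext: "near_extremal k X Y" and k: "k \<ge> 1"
    and T: "\<And>s t. s \<in> T \<Longrightarrow> t \<in> T \<Longrightarrow> s \<noteq> t \<Longrightarrow> h s t" "card T = 4" "T \<inter> (X \<union> Y) = {}"
    and two: "\<And>x. x \<in> X \<union> Y \<Longrightarrow> card {t \<in> T. h x t} = 2"
  shows "\<exists>A B. A \<union> B = X \<union> Y \<union> T \<and> A \<inter> B = {} \<and> matching A \<and> matching B"
proof -
  let ?N = "\<lambda>x. {t \<in> T. h x t}"
  have "card X = 2 * k" using near_extremal_count[OF ext] by auto
  then have "X \<noteq> {}" using k by auto
  then obtain x0 where x0: "x0 \<in> X" by blast
  define P where "P = ?N x0"
  define Q where "Q = T - P"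
  have P: "P \<subseteq> T" "card P = 2" using two[of x0] x0 by (auto simp: P_def)
  then have cQ: "card Q = 2" using card_clique_complement[OF T(2)] by (simp add: Q_def)
  obtain s t where st: "P = {s, t}" "s \<noteq> t" using P(2) by (auto simp: card_2_iff)
  obtain p q where pq: "Q = {p, q}" "p \<noteq> q" using cQ by (auto simp: card_2_iff)
  have sT: "s \<in> T" "t \<in> T" "p \<in> T" "q \<in> T" using st P pq by (auto simp: Q_def)
  have TQ: "T - Q = P" using P(1) by (auto simp: Q_def)
  have class_cases: "M' = P \<or> M' = Q" if "M' = M \<or> M' = T - M" "M = P \<or> M = Q" for M M'
    using that TQ Q_def by metis
  have cl: "?N y = ?N x \<or> ?N y = T - ?N x"
    if "card (?N x) = 2" "card (?N y) = 2" "h x y" "x \<notin> T" "y \<notin> T" for x y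
    by (rule clique_classes[OF _ T(2) that]) (rule T(1))
  have step: "?N y = P \<or> ?N y = Q" if "x \<in> X \<union> Y" "y \<in> X \<union> Y" "h x y" "?N x = P \<or> ?N x = Q" for x y
  proof (rule class_cases[OF cl[OF two[OF that(1)] two[OF that(2)] that(3)] that(4)])
    show "x \<notin> T" "y \<notin> T" using that(1,2) T(3) by blast+
  qed
  have PQ: "?N x = P \<or> ?N x = Q" if "x \<in> X \<union> Y" for x
  proof -
    define R where "R x \<longleftrightarrow> ?N x = P \<or> ?N x = Q" for x
    have "R y" if "x \<in> X \<union> Y" "y \<in> X \<union> Y" "h x y" "R x" for x y
      using step[OF that(1-3)] that(4) unfolding R_def by blast
    moreover have "R x0" by (simp add: R_def P_def)
    ultimately have "R x" using near_extremal_link[OF ext k _ x0 _ that, of R] by blast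
    then show ?thesis unfolding R_def .
  qed
  define C where "C = {x \<in> X \<union> Y. ?N x = P}"
  define D where "D = {x \<in> X \<union> Y. ?N x = Q}"
  have "s \<notin> Q" using st by (auto simp: Q_def)
  then have "P \<noteq> Q" using st(1) by auto
  then have CD: "C \<union> D = X \<union> Y" "C \<inter> D = {}"
    using PQ by (auto simp: C_def D_def)
  have Cst: "h x s \<and> h x t" if "x \<in> C" for x
    using that st(1) unfolding C_def by blast
  have Dpq: "h x p \<and> h x q" if "x \<in> D" for x
    using that pq(1) unfolding D_def by blast
  have mC: "matching C" by (rule class_matching[of s t]) (use T(1) sT st Cst in blast)+
  have mD: "matching D" by (rule class_matching[of p q]) (use T(1) sT pq Dpq in blast)+
  have A: "matching (C \<union> Q)"
  proof (rule matching_Un_pair[OF mC cQ])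
    show "\<not> h x y" if "x \<in> C" "y \<in> Q" for x y
      using that unfolding C_def Q_def by blast
  qed
  have B: "matching (D \<union> P)"
  proof (rule matching_Un_pair[OF mD P(2)])
    show "\<not> h x y" if "x \<in> D" "y \<in> P" for x y
      using that P(1) unfolding D_def Q_def by blast
  qed
  have cover: "(C \<union> Q) \<union> (D \<union> P) = X \<union> Y \<union> T" "(C \<union> Q) \<inter> (D \<union> P) = {}"
  proof -
    have PQT: "P \<union> Q = T" "P \<inter> Q = {}" using P(1) by (auto simp: Q_def)
    have "(C \<union> Q) \<union> (D \<union> P) = (C \<union> D) \<union> (P \<union> Q)" by blast
    then show "(C \<union> Q) \<union> (D \<union> P) = X \<union> Y \<union> T" unfolding PQT(1) CD(1) .
    have "(C \<union> D) \<inter> T = {}" "P \<subseteq> T" "Q \<subseteq> T" using CD(1) T(3) PQT by blast+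
    then show "(C \<union> Q) \<inter> (D \<union> P) = {}" using CD(2) PQT(2) by blast
  qed
  show ?thesis
  proof (rule exI, rule exI, rule conjI[OF cover(1) conjI[OF cover(2) conjI[OF A B]]])
  qed
qed

text \<open>The assumed count is within 2 of its maximum
  \<open>8 * k\<^sup>2 + 4 * k + 2 * (8 * k)\<close>. A vertex \<open>w\<close> with fewer than two
  clique neighbours takes the whole allowance: it has exactly one, every other vertex has two, and
  \<open>X \<union> Y\<close> attains the bound.\<close>

lemma near_extremal_partition_step:
  assumes ext: "near_extremal k X Y" and k: "k \<ge> 1"
    and T: "\<And>s t. s \<in> T \<Longrightarrow> t \<in> T \<Longrightarrow> s \<noteq> t \<Longrightarrow> h s t" "card T = 4" "T \<inter> (X \<union> Y) = {}"
    and le: "\<And>x. x \<in> X \<union> Y \<Longrightarrow> card {t \<in> T. h x t} \<le> 2"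
    and arcs: "arcs (X \<union> Y) + 2 * (\<Sum>x\<in>X \<union> Y. card {t \<in> T. h x t}) + 2 \<ge> 8 * k\<^sup>2 + 20 * k"
  shows "\<exists>A B. A \<union> B = X \<union> Y \<union> T \<and> A \<inter> B = {} \<and> matching A \<and> matching B"
proof (cases "\<forall>x\<in>X \<union> Y. card {t \<in> T. h x t} = 2")
  case True
  then show ?thesis using near_extremal_regular_partition[OF ext k T] by blast
next
  case False
  let ?n = "\<lambda>x. card {t \<in> T. h x t}" and ?V = "X \<union> Y"
  obtain w where w: "w \<in> ?V" "?n w \<noteq> 2" using False by blast
  then have w1: "?n w \<le> 1" using le[of w] by linarith
  have fin: "finite ?V" and cV: "card ?V = 4 * k" using ext by (auto simp: near_extremal_def)
  have split: "sum ?n ?V = ?n w + sum ?n (?V - {w})" using fin w(1) by (rule sum.remove)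
  have cw: "card (?V - {w}) = 4 * k - 1" using fin w(1) cV by simp
  have "sum ?n (?V - {w}) \<le> (4 * k - 1) * 2"
    using sum_bounded_above[of "?V - {w}" ?n 2] le unfolding cw by simp
  then have arcs1: "arcs ?V \<ge> 8 * k\<^sup>2 + 4 * k" using arcs split w1 k by linarith
  have S: "sum ?n ?V + 1 \<ge> 8 * k" using arcs_upper_bound[OF fin cV] arcs by linarith
  have two: "?n x = 2" if x: "x \<in> ?V - {w}" for x
  proof (rule ccontr)
    assume "?n x \<noteq> 2"
    then have x1: "?n x \<le> 1" using le[of x] x by simp
    have split': "sum ?n (?V - {w}) = ?n x + sum ?n (?V - {w} - {x})" using fin x by (intro sum.remove) auto
    have "card (?V - {w} - {x}) = 4 * k - 2" using fin x cw by simp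
    then have "sum ?n (?V - {w} - {x}) \<le> (4 * k - 2) * 2"
      using sum_bounded_above[of "?V - {w} - {x}" ?n 2] le by simp
    then show False using S split split' w1 x1 k by linarith
  qed
  have "sum ?n (?V - {w}) = (4 * k - 1) * 2" using two cw by simp
  then have w1: "?n w = 1" using S split w1 k by linarith
  show ?thesis
  proof (cases "w \<in> X")
    case True
    then show ?thesis using extremal_exceptional_partition[OF ext k T arcs1 _ w1 two] by blast
  next
    case False
    then have "w \<in> Y" using w by blast
    moreover have "T \<inter> (Y \<union> X) = {}" "arcs (Y \<union> X) \<ge> 8 * k\<^sup>2 + 4 * k"
      using T(3) arcs1 by (auto simp: Un_commute)
    ultimately have "\<exists>A B. A \<union> B = Y \<union> X \<union> T \<and> A \<inter> B = {} \<and> matching A \<and> matching B"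
      using extremal_exceptional_partition[OF near_extremal_sym[OF ext] k T(1,2) _ _ _ w1] two
      by (simp add: Un_commute)
    then show ?thesis by (simp add: Un_commute)
  qed
qed

theorem near_extremal_partition:
  assumes "finite V" "card V = 4 * k" "k \<ge> 1" "arcs V + 2 \<ge> 8 * k\<^sup>2 + 4 * k"
  shows "\<exists>A B. A \<union> B = V \<and> A \<inter> B = {} \<and> matching A \<and> matching B"
  using assms
proof (induction k arbitrary: V)
  case 0
  then show ?case by simp
next
  case (Suc k V)
  note fin = Suc.prems(1) and card = Suc.prems(2)
  show ?case
  proof (cases "k = 0")
    case True
    \<comment> \<open>On four vertices any split into two pairs works, since a pair is always a
      matching.\<close>
    then obtain A where A: "A \<subseteq> V" "card A = 2"
      using card obtain_subset_with_card_n[of 2 V] by auto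
    have "card (V - A) = 2" using A card True fin by (simp add: card_Diff_subset finite_subset)
    then have "matching A" "matching (V - A)"
      using matching_Un_pair[of "{}"] A(2) by (auto simp: matching_def)
    then show ?thesis using A(1) by (intro exI[of _ A] exI[of _ "V - A"]) auto
  next
    case False
    have "\<not> K4_free V"
      using arcs_K4_free[OF fin card] False Suc.prems(4) by auto
    then obtain a b c d where abcd: "{a, b, c, d} \<subseteq> V" and K: "K4 a b c d"
      unfolding K4_free_def by blast
    let ?T = "{a, b, c, d}"
    note rem = arcs_remove_K4[OF fin abcd K]
    have cT: "card ?T = 4" using K4_distinct[OF K] by simp
    have T: "h s t" if "s \<in> ?T" "t \<in> ?T" "s \<noteq> t" for s t
      using that K sym unfolding K4_def by blast
    have "card (V - ?T) = 4 * k" "arcs (V - ?T) + 2 \<ge> 8 * k\<^sup>2 + 4 * k"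
      using rem card Suc.prems(4) by (auto simp: power2_eq_square algebra_simps)
    moreover from this obtain X Y where XY: "X \<union> Y = V - ?T" "X \<inter> Y = {}" "matching X" "matching Y"
      using Suc.IH[of "V - ?T"] fin False by auto
    ultimately have ext: "near_extremal k X Y"
      using fin finite_subset[of X V] finite_subset[of Y V] by (auto simp: near_extremal_def)
    have deg: "deg ?T x = card {t \<in> ?T. h x t}" for x by (rule deg_eq_card) simp
    have "\<exists>A B. A \<union> B = X \<union> Y \<union> ?T \<and> A \<inter> B = {} \<and> matching A \<and> matching B"
    proof (rule near_extremal_partition_step[OF ext _ T cT])
      show "card {t \<in> ?T. h x t} \<le> 2" if "x \<in> X \<union> Y" for x
        using K4_deg[OF K, of x] that XY(1) unfolding deg by blast
      show "arcs (X \<union> Y) + 2 * (\<Sum>x\<in>X \<union> Y. card {t \<in> ?T. h x t}) + 2 \<ge> 8 * k\<^sup>2 + 20 * k"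
        using Suc.prems(4) arcs_remove[OF fin abcd] K4_arcs[OF K] unfolding XY(1) deg
        by (simp add: power2_eq_square algebra_simps)
    qed (use False XY in auto)
    moreover have "X \<union> Y \<union> ?T = V" using XY(1) abcd by auto
    ultimately show ?thesis by simp
  qed
qed

end

section \<open>The spectral radius\<close>

text \<open>Eigenvalues of \<open>adjacency_matrix G\<close> with eigenvectors read as functions on
  vertices, so that the arbitrary enumeration disappears from all later arguments.\<close>

definition graph_eigenvalue :: "'a pair_pre_digraph \<Rightarrow> real \<Rightarrow> bool" where
  "graph_eigenvalue G \<mu> \<longleftrightarrow> (\<exists>f. (\<exists>v\<in>pverts G. f v \<noteq> 0) \<and>
     (\<forall>v\<in>pverts G. (\<Sum>w\<in>pverts G. of_bool ((v, w) \<in> parcs G) * f w) = \<mu> * f v))"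

lemma
  assumes "finite (pverts G)"
  shows spectrum_adjacency_matrix: "spectrum (adjacency_matrix G) = Collect (graph_eigenvalue G)"
    and finite_spectrum_adjacency_matrix: "finite (spectrum (adjacency_matrix G))"
proof -
  define vs where "vs = (SOME vs. distinct vs \<and> set vs = pverts G)"
  have "\<exists>vs. distinct vs \<and> set vs = pverts G" using finite_distinct_list[OF assms] by blast
  then have vs: "distinct vs" "set vs = pverts G"
    unfolding vs_def by (rule someI2_ex; simp)+
  define n where "n = length vs"
  define A where "A = mat n n (\<lambda>(i, j). of_bool ((vs ! i, vs ! j) \<in> parcs G) :: real)"
  have adj: "adjacency_matrix G = A"
    by (simp add: adjacency_matrix_def A_def n_def vs_def[symmetric] Let_def of_bool_def)
  have A: "A \<in> carrier_mat n n" by (simp add: A_def)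
  show "finite (spectrum (adjacency_matrix G))" unfolding adj by (rule card_finite_spectrum[OF A])
  have bij: "bij_betw ((!) vs) {0..<n} (pverts G)"
    using bij_betw_nth[OF vs(1), of "{0..<n}" "pverts G"] vs(2) by (simp add: n_def atLeast0LessThan)
  have mult: "(A *\<^sub>v vec n (\<lambda>i. f (vs ! i))) $ i = (\<Sum>w\<in>pverts G. of_bool ((vs ! i, w) \<in> parcs G) * f w)"
    if "i < n" for i f
  proof -
    have "(A *\<^sub>v vec n (\<lambda>i. f (vs ! i))) $ i = (\<Sum>j = 0..<n. of_bool ((vs ! i, vs ! j) \<in> parcs G) * f (vs ! j))"
      using that by (auto simp: A_def scalar_prod_def intro!: sum.cong)
    also have "\<dots> = (\<Sum>w\<in>pverts G. of_bool ((vs ! i, w) \<in> parcs G) * f w)"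
      by (rule sum.reindex_bij_betw[OF bij])
    finally show ?thesis .
  qed
  have all: "(\<forall>v\<in>pverts G. P v) \<longleftrightarrow> (\<forall>i<n. P (vs ! i))" for P
    using bij_betw_imp_surj_on[OF bij] by (metis atLeast0LessThan imageE image_eqI lessThan_iff)
  have ev: "eigenvector A (vec n (\<lambda>i. f (vs ! i))) \<mu> \<longleftrightarrow> (\<exists>v\<in>pverts G. f v \<noteq> 0) \<and>
     (\<forall>v\<in>pverts G. (\<Sum>w\<in>pverts G. of_bool ((v, w) \<in> parcs G) * f w) = \<mu> * f v)" for f \<mu>
  proof -
    have "vec n (\<lambda>i. f (vs ! i)) \<noteq> 0\<^sub>v n \<longleftrightarrow> \<not> (\<forall>v\<in>pverts G. f v = 0)"
      unfolding all by (auto simp: vec_eq_iff)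
    moreover have "A *\<^sub>v vec n (\<lambda>i. f (vs ! i)) = \<mu> \<cdot>\<^sub>v vec n (\<lambda>i. f (vs ! i)) \<longleftrightarrow>
      (\<forall>v\<in>pverts G. (\<Sum>w\<in>pverts G. of_bool ((v, w) \<in> parcs G) * f w) = \<mu> * f v)"
      unfolding all using A mult[of _ f] by (auto simp: vec_eq_iff simp del: index_mult_mat_vec)
    ultimately show ?thesis using A by (auto simp: eigenvector_def)
  qed
  have vec: "\<exists>f. x = vec n (\<lambda>i. f (vs ! i))" if "x \<in> carrier_vec n" for x :: "real vec"
  proof -
    have "x $ i = x $ (the_inv_into {0..<n} ((!) vs) (vs ! i))" if "i < n" for i
      using the_inv_into_f_f[OF bij_betw_imp_inj_on[OF bij], of i] that by simp
    then have "x = vec n (\<lambda>i. (\<lambda>v. x $ (the_inv_into {0..<n} ((!) vs) v)) (vs ! i))"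
      using that by (auto simp: vec_eq_iff)
    then show ?thesis by (rule exI[of _ "\<lambda>v. x $ (the_inv_into {0..<n} ((!) vs) v)"])
  qed
  have "eigenvalue A \<mu> \<longleftrightarrow> graph_eigenvalue G \<mu>" for \<mu>
  proof
    assume "eigenvalue A \<mu>"
    then obtain x where x: "eigenvector A x \<mu>" by (auto simp: eigenvalue_def)
    then have "x \<in> carrier_vec n" using A by (auto simp: eigenvector_def)
    then obtain f where "x = vec n (\<lambda>i. f (vs ! i))" using vec by blast
    then show "graph_eigenvalue G \<mu>" using x ev[of f] unfolding graph_eigenvalue_def by auto
  next
    assume "graph_eigenvalue G \<mu>"
    then obtain f where "eigenvector A (vec n (\<lambda>i. f (vs ! i))) \<mu>"
      unfolding graph_eigenvalue_def ev[symmetric] by blast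
    then show "eigenvalue A \<mu>" by (auto simp: eigenvalue_def)
  qed
  then show "spectrum (adjacency_matrix G) = Collect (graph_eigenvalue G)"
    by (auto simp: adj spectrum_def)
qed

text \<open>The first-order condition at a maximum: for \<open>t = c / s\<close> with
  \<open>s\<close> above the modulus of \<open>d\<close>, the linear term would dominate and make
  the sum positive.\<close>

lemma quadratic_nonpos_imp_linear_zero:
  fixes c d :: real
  assumes "\<And>t. 2 * t * c + t\<^sup>2 * d \<le> 0"
  shows "c = 0"
proof (rule ccontr)
  assume "c \<noteq> 0"
  define s where "s = \<bar>d\<bar> + 1"
  have s: "s > 0" "d > - s" by (auto simp: s_def)
  have "2 * (c / s) * c + (c / s)\<^sup>2 * d = c\<^sup>2 * (2 * s + d) / s\<^sup>2"
    using s by (simp add: field_simps power2_eq_square)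
  moreover have "c\<^sup>2 * (2 * s + d) / s\<^sup>2 > 0" using s \<open>c \<noteq> 0\<close> by simp
  ultimately show False using assms[of "c / s"] by simp
qed

text \<open>The Rayleigh principle. The form attains its maximum on the unit sphere at some
  \<open>f\<close>, and varying \<open>f\<close> along its own residual \<open>r\<close> makes the
  first-order coefficient the squared norm of \<open>r\<close>, which must vanish.\<close>

lemma symmetric_form_maximizer:
  fixes e :: "'a \<Rightarrow> 'a \<Rightarrow> real"
  assumes V: "finite V" "V \<noteq> {}" and sym: "\<And>v w. e v w = e w v"
  obtains \<mu> f where "\<exists>v\<in>V. f v \<noteq> 0" "\<And>v. v \<in> V \<Longrightarrow> (\<Sum>w\<in>V. e v w * f w) = \<mu> * f v"
    "\<And>g. (\<Sum>v\<in>V. \<Sum>w\<in>V. e v w * g v * g w) \<le> \<mu> * (\<Sum>v\<in>V. (g v)\<^sup>2)"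
proof -
  define B where "B f g = (\<Sum>v\<in>V. \<Sum>w\<in>V. e v w * f v * g w)" for f g :: "'a \<Rightarrow> real"
  define N where "N f g = (\<Sum>v\<in>V. f v * g v)" for f g :: "'a \<Rightarrow> real"
  \<comment> \<open>Pinning the coordinates outside \<open>V\<close> to 0 keeps the box compact in
    the product topology, even over an infinite type.\<close>
  define S where "S v = (if v \<in> V then {-1..1} else {0 :: real})" for v
  define K where "K = PiE UNIV S \<inter> {f. N f f = 1}"
  have cont: "continuous_on UNIV (\<lambda>f. f v)" for v :: 'a
    by (rule continuous_on_product_coordinates)
  have contB: "continuous_on UNIV (\<lambda>f. B f f)" and contN: "continuous_on UNIV (\<lambda>f. N f f)"
    unfolding B_def N_def by (intro continuous_intros cont)+
  have "compact (PiE UNIV S)"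
    using compactin_PiE[of "\<lambda>_. euclideanreal" UNIV S]
    by (simp add: euclidean_product_topology S_def)
  moreover have "closed {f. N f f = 1}"
    using continuous_closed_preimage[OF contN, of "{1}"] by (simp add: vimage_def)
  ultimately have "compact K" unfolding K_def by (rule compact_Int_closed)
  have N_nonneg: "N g g \<ge> 0" for g by (auto simp: N_def intro: sum_nonneg)
  have normalize: "(\<lambda>v. if v \<in> V then g v / sqrt (N g g) else 0) \<in> K" if "N g g \<noteq> 0" for g
  proof -
    have pos: "N g g > 0" using N_nonneg[of g] that by simp
    let ?h = "\<lambda>v. if v \<in> V then g v / sqrt (N g g) else 0"
    have "(g v)\<^sup>2 \<le> N g g" if "v \<in> V" for v
      unfolding N_def power2_eq_square using V(1) that by (intro member_le_sum) auto
    then have "\<bar>g v\<bar> \<le> sqrt (N g g)" if "v \<in> V" for v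
      using that by (metis real_sqrt_abs real_sqrt_le_iff)
    then have "?h \<in> PiE UNIV S" using pos by (auto simp: S_def pos_divide_le_eq pos_le_divide_eq abs_le_iff minus_le_iff)
    moreover have "N ?h ?h = 1"
    proof -
      have "N ?h ?h = (\<Sum>v\<in>V. (g v * g v) / N g g)"
        using pos unfolding N_def[of ?h ?h] by (intro sum.cong) (auto simp: field_simps)
      then show ?thesis using pos by (simp add: N_def sum_divide_distrib[symmetric])
    qed
    ultimately show ?thesis by (simp add: K_def)
  qed
  have "N (\<lambda>_. 1) (\<lambda>_. 1) \<noteq> 0" using V by (simp add: N_def)
  then have "K \<noteq> {}" using normalize by blast
  then obtain f where f: "f \<in> K" "\<And>g. g \<in> K \<Longrightarrow> B g g \<le> B f f"
    using continuous_attains_sup[OF \<open>compact K\<close>, of "\<lambda>f. B f f"] contB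
    by (meson continuous_on_subset subset_UNIV)
  define \<mu> where "\<mu> = B f f"
  have Nf: "N f f = 1" using f by (simp add: K_def)
  have max: "B g g \<le> \<mu> * N g g" for g
  proof (cases "N g g = 0")
    case True
    then have "g v = 0" if "v \<in> V" for v
      using that V(1) by (simp add: N_def sum_nonneg_eq_0_iff)
    then show ?thesis using True by (simp add: B_def)
  next
    case False
    then have pos: "N g g > 0" using N_nonneg[of g] by simp
    let ?h = "\<lambda>v. if v \<in> V then g v / sqrt (N g g) else 0"
    have "B ?h ?h = (\<Sum>v\<in>V. \<Sum>w\<in>V. (e v w * g v * g w) / N g g)"
      using pos unfolding B_def by (intro sum.cong refl) (auto simp: field_simps)
    then have "B ?h ?h = B g g / N g g" by (simp add: B_def sum_divide_distrib)
    then have "B g g / N g g \<le> \<mu>" using f(2)[OF normalize[OF False]] by (simp only: \<mu>_def)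
    then show ?thesis using pos by (simp only: pos_divide_le_eq)
  qed
  define r where "r v = (\<Sum>w\<in>V. e v w * f w) - \<mu> * f v" for v
  have B_comm: "B g h = B h g" for g h
    unfolding B_def by (subst sum.swap) (simp add: sym mult.commute mult.left_commute)
  have Brf: "B r f = N r (\<lambda>v. \<Sum>w\<in>V. e v w * f w)"
    by (simp add: B_def N_def sum_distrib_left mult.commute mult.left_commute)
  have Nrr: "N r r = B r f - \<mu> * N r f"
  proof -
    have "r v * r v = r v * (\<Sum>w\<in>V. e v w * f w) - \<mu> * (r v * f v)" for v
      unfolding mult.left_commute[of \<mu>] right_diff_distrib[symmetric] by (simp only: r_def)
    then show ?thesis unfolding Brf N_def sum_distrib_left[of \<mu>] sum_subtractf[symmetric] by simp
  qed
  have "2 * t * N r r + t\<^sup>2 * (B r r - \<mu> * N r r) \<le> 0" for t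
  proof -
    let ?g = "\<lambda>v. f v + t * r v"
    have "B ?g ?g = B f f + t * B f r + t * B r f + t\<^sup>2 * B r r"
    proof -
      have "B ?g ?g = (\<Sum>v\<in>V. \<Sum>w\<in>V. e v w * f v * f w + t * (e v w * f v * r w)
          + t * (e v w * r v * f w) + t\<^sup>2 * (e v w * r v * r w))"
        unfolding B_def by (intro sum.cong refl) (simp add: algebra_simps power2_eq_square)
      then show ?thesis by (simp only: B_def sum.distrib sum_distrib_left)
    qed
    moreover have "N ?g ?g = N f f + 2 * t * N r f + t\<^sup>2 * N r r"
    proof -
      have "N ?g ?g = (\<Sum>v\<in>V. f v * f v + 2 * t * (r v * f v) + t\<^sup>2 * (r v * r v))"
        unfolding N_def by (intro sum.cong refl) (simp add: algebra_simps power2_eq_square)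
      then show ?thesis by (simp only: N_def sum.distrib sum_distrib_left)
    qed
    ultimately have "\<mu> + t * B r f + t * B r f + t\<^sup>2 * B r r \<le> \<mu> * (1 + 2 * t * N r f + t\<^sup>2 * N r r)"
      using max[of ?g] by (simp only: \<mu>_def Nf B_comm[of f r])
    moreover have "2 * t * N r r = 2 * t * B r f - 2 * t * (\<mu> * N r f)"
      unfolding right_diff_distrib[symmetric] using Nrr by simp
    ultimately show ?thesis by (simp add: algebra_simps)
  qed
  then have "N r r = 0" by (rule quadratic_nonpos_imp_linear_zero)
  then have "r v = 0" if "v \<in> V" for v
    using that V(1) by (simp add: N_def sum_nonneg_eq_0_iff)
  then have "(\<Sum>w\<in>V. e v w * f w) = \<mu> * f v" if "v \<in> V" for v
    using that by (simp add: r_def)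
  moreover have "\<exists>v\<in>V. f v \<noteq> 0"
  proof (rule ccontr)
    assume "\<not> ?thesis"
    then have "N f f = 0" by (simp add: N_def)
    then show False using Nf by simp
  qed
  ultimately show ?thesis using that[of f \<mu>] max by (simp add: B_def N_def power2_eq_square)
qed

text \<open>The Rayleigh bound tested on the constant function 1. Nonemptiness of the spectrum is
  recorded for later reasoning about \<open>Max\<close>.\<close>

theorem average_degree_le_spectral_radius:
  assumes "pair_graph G" "pverts G \<noteq> {}"
  shows "real (card (parcs G)) / card (pverts G) \<le> graph_spectral_radius G"
    and "spectrum (adjacency_matrix G) \<noteq> {}"
proof -
  interpret pair_graph G by fact
  let ?V = "pverts G" and ?e = "\<lambda>v w. of_bool ((v, w) \<in> parcs G) :: real"
  have fin: "finite ?V" by (rule pair_finite_verts)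
  have sym: "?e v w = ?e w v" for v w
    using arcs_symmetric[of v w] arcs_symmetric[of w v] by (auto simp: of_bool_def)
  obtain \<mu> f where f: "\<exists>v\<in>?V. f v \<noteq> 0" "\<And>v. v \<in> ?V \<Longrightarrow> (\<Sum>w\<in>?V. ?e v w * f w) = \<mu> * f v"
    and max: "\<And>g. (\<Sum>v\<in>?V. \<Sum>w\<in>?V. ?e v w * g v * g w) \<le> \<mu> * (\<Sum>v\<in>?V. (g v)\<^sup>2)"
    by (rule symmetric_form_maximizer[of ?V ?e, OF fin assms(2) sym]) (rule that)
  have "graph_eigenvalue G \<mu>" unfolding graph_eigenvalue_def using f by blast
  then have mem: "\<mu> \<in> spectrum (adjacency_matrix G)" using spectrum_adjacency_matrix[OF fin] by simp
  then show "spectrum (adjacency_matrix G) \<noteq> {}" by blast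
  have "\<mu> \<le> graph_spectral_radius G"
    unfolding graph_spectral_radius_def using finite_spectrum_adjacency_matrix[OF fin] mem by (rule Max_ge)
  moreover have "real (card (parcs G)) \<le> \<mu> * card ?V"
  proof -
    have "parcs G \<subseteq> ?V \<times> ?V" using in_arcsD1 in_arcsD2 by auto
    then have "(\<Sum>p\<in>?V \<times> ?V. of_bool (p \<in> parcs G) :: real) = card (parcs G)"
      using fin by (simp add: Int_absorb1)
    then have "(\<Sum>v\<in>?V. \<Sum>w\<in>?V. ?e v w) = card (parcs G)"
      by (simp add: sum.cartesian_product case_prod_beta del: sum_of_bool_eq)
    then show ?thesis using max[of "\<lambda>_. 1"] by (simp del: sum_of_bool_eq)
  qed
  moreover have "card ?V > 0" using fin assms(2) by (simp add: card_gt_0_iff)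
  ultimately show "real (card (parcs G)) / card (pverts G) \<le> graph_spectral_radius G"
    by (simp add: field_simps) (meson mult_right_mono of_nat_0_le_iff order_trans)
qed

text \<open>A Collatz-Wielandt bound that avoids a Perron vector. Any eigenfunction \<open>f\<close>
  satisfies \<open>\<mu> * \<bar>f\<bar> \<le> A \<bar>f\<bar>\<close>; pairing with
  \<open>p\<close> and moving the symmetric matrix over to \<open>p\<close> compares \<mu> with
  \<theta>. Strictness comes from a vertex where \<open>f\<close> is nonzero.\<close>

theorem spectral_radius_less:
  assumes G: "pair_graph G" "pverts G \<noteq> {}"
    and p: "\<And>v. v \<in> pverts G \<Longrightarrow> p v > 0"
      "\<And>v. v \<in> pverts G \<Longrightarrow> (\<Sum>w\<in>pverts G. of_bool ((v, w) \<in> parcs G) * p w) < \<theta> * p v"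
  shows "graph_spectral_radius G < \<theta>"
proof -
  interpret pair_graph G by fact
  let ?V = "pverts G" and ?e = "\<lambda>v w. of_bool ((v, w) \<in> parcs G) :: real"
  have fin: "finite ?V" by (rule pair_finite_verts)
  have sym: "?e v w = ?e w v" for v w
    using arcs_symmetric[of v w] arcs_symmetric[of w v] by (auto simp: of_bool_def)
  have "\<mu> < \<theta>" if ev: "graph_eigenvalue G \<mu>" for \<mu>
  proof -
    obtain f where "(\<exists>v\<in>?V. f v \<noteq> 0) \<and> (\<forall>v\<in>?V. (\<Sum>w\<in>?V. ?e v w * f w) = \<mu> * f v)"
      using ev unfolding graph_eigenvalue_def by (rule exE)
    then have f: "\<exists>v\<in>?V. f v \<noteq> 0" "\<And>v. v \<in> ?V \<Longrightarrow> (\<Sum>w\<in>?V. ?e v w * f w) = \<mu> * f v"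
      by simp_all
    obtain u where u: "u \<in> ?V" "f u \<noteq> 0" using f(1) by blast
    have "\<mu> * \<bar>f v\<bar> \<le> (\<Sum>w\<in>?V. ?e v w * \<bar>f w\<bar>)" if "v \<in> ?V" for v
    proof -
      have "\<mu> * \<bar>f v\<bar> \<le> \<bar>\<mu> * f v\<bar>" by (simp add: abs_mult mult_right_mono)
      also have "\<dots> \<le> (\<Sum>w\<in>?V. \<bar>?e v w * f w\<bar>)" unfolding f(2)[OF that, symmetric] by (rule sum_abs)
      finally show ?thesis by (simp add: abs_mult)
    qed
    then have "(\<Sum>v\<in>?V. p v * (\<mu> * \<bar>f v\<bar>)) \<le> (\<Sum>v\<in>?V. p v * (\<Sum>w\<in>?V. ?e v w * \<bar>f w\<bar>))"
      using p(1) by (intro sum_mono mult_left_mono) (auto simp: less_imp_le)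
    also have "\<dots> = (\<Sum>v\<in>?V. \<Sum>w\<in>?V. ?e w v * p v * \<bar>f w\<bar>)"
      unfolding sum_distrib_left by (intro sum.cong refl) (simp add: sym)
    also have "\<dots> = (\<Sum>w\<in>?V. \<bar>f w\<bar> * (\<Sum>v\<in>?V. ?e w v * p v))"
      unfolding sum_distrib_left by (subst sum.swap, intro sum.cong refl) (simp only: ac_simps)
    also have "\<dots> < (\<Sum>w\<in>?V. \<bar>f w\<bar> * (\<theta> * p w))"
    proof (rule sum_strict_mono_ex1[OF fin])
      show "\<forall>x\<in>?V. \<bar>f x\<bar> * (\<Sum>v\<in>?V. ?e x v * p v) \<le> \<bar>f x\<bar> * (\<theta> * p x)"
        using p(2) by (intro ballI mult_left_mono) (auto simp: less_imp_le)
      show "\<exists>x\<in>?V. \<bar>f x\<bar> * (\<Sum>v\<in>?V. ?e x v * p v) < \<bar>f x\<bar> * (\<theta> * p x)"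
        using u p(2)[OF u(1)] by (intro bexI[of _ u] mult_strict_left_mono) auto
    qed
    finally have "\<mu> * (\<Sum>v\<in>?V. p v * \<bar>f v\<bar>) < \<theta> * (\<Sum>v\<in>?V. p v * \<bar>f v\<bar>)"
      unfolding sum_distrib_left by (simp only: ac_simps)
    moreover have "(\<Sum>v\<in>?V. p v * \<bar>f v\<bar>) \<ge> 0" using p(1) by (intro sum_nonneg) (simp add: less_imp_le)
    ultimately show ?thesis by (simp add: mult_less_cancel_right)
  qed
  then show ?thesis
    unfolding graph_spectral_radius_def
    using finite_spectrum_adjacency_matrix[OF fin] average_degree_le_spectral_radius(2)[OF G]
      spectrum_adjacency_matrix[OF fin] by (subst Max_less_iff) auto
qed

section \<open>Invariance under isomorphism\<close>

lemma graph_eigenvalue_transport: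
  assumes \<phi>: "bij_betw \<phi> (pverts G) (pverts H)"
    and arcs: "\<And>u v. u \<in> pverts G \<Longrightarrow> v \<in> pverts G \<Longrightarrow> (u, v) \<in> parcs G \<longleftrightarrow> (\<phi> u, \<phi> v) \<in> parcs H"
    and "graph_eigenvalue H \<mu>"
  shows "graph_eigenvalue G \<mu>"
proof -
  obtain f where "(\<exists>v\<in>pverts H. f v \<noteq> 0) \<and>
      (\<forall>v\<in>pverts H. (\<Sum>w\<in>pverts H. of_bool ((v, w) \<in> parcs H) * f w) = \<mu> * f v)"
    using assms(3) unfolding graph_eigenvalue_def by (rule exE)
  then have f: "\<exists>v\<in>pverts H. f v \<noteq> 0"
    "\<And>v. v \<in> pverts H \<Longrightarrow> (\<Sum>w\<in>pverts H. of_bool ((v, w) \<in> parcs H) * f w) = \<mu> * f v"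
    by blast+
  have "(\<Sum>w\<in>pverts G. of_bool ((v, w) \<in> parcs G) * f (\<phi> w)) = \<mu> * f (\<phi> v)" if "v \<in> pverts G" for v
  proof -
    have "(\<Sum>w\<in>pverts G. of_bool ((v, w) \<in> parcs G) * f (\<phi> w)) = (\<Sum>w\<in>pverts G. of_bool ((\<phi> v, \<phi> w) \<in> parcs H) * f (\<phi> w))"
      using arcs[OF that] by (intro sum.cong) auto
    also have "\<dots> = (\<Sum>w\<in>pverts H. of_bool ((\<phi> v, w) \<in> parcs H) * f w)"
      by (rule sum.reindex_bij_betw[OF \<phi>])
    finally show ?thesis using f(2) that \<phi> by (auto simp: bij_betw_def)
  qed
  moreover have "\<exists>v\<in>pverts G. f (\<phi> v) \<noteq> 0" using f(1) unfolding bij_betw_imp_surj_on[OF \<phi>, symmetric] by simp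
  ultimately show ?thesis unfolding graph_eigenvalue_def by (intro exI[of _ "\<lambda>v. f (\<phi> v)"]) blast
qed

lemma graph_spectral_radius_iso:
  assumes fin: "finite (pverts G)" and \<phi>: "bij_betw \<phi> (pverts G) (pverts H)"
    and arcs: "\<And>u v. u \<in> pverts G \<Longrightarrow> v \<in> pverts G \<Longrightarrow> (u, v) \<in> parcs G \<longleftrightarrow> (\<phi> u, \<phi> v) \<in> parcs H"
  shows "graph_spectral_radius G = graph_spectral_radius H"
proof -
  have inv: "bij_betw (the_inv_into (pverts G) \<phi>) (pverts H) (pverts G)"
    by (rule bij_betw_the_inv_into[OF \<phi>])
  have "graph_eigenvalue H \<mu>" if "graph_eigenvalue G \<mu>" for \<mu>
  proof (rule graph_eigenvalue_transport[OF inv _ that])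
    fix u v assume "u \<in> pverts H" "v \<in> pverts H"
    then show "(u, v) \<in> parcs H \<longleftrightarrow> (the_inv_into (pverts G) \<phi> u, the_inv_into (pverts G) \<phi> v) \<in> parcs G"
      using arcs[of "the_inv_into (pverts G) \<phi> u" "the_inv_into (pverts G) \<phi> v"]
        bij_betwE[OF inv] f_the_inv_into_f_bij_betw[OF \<phi>] by simp
  qed
  then have "graph_eigenvalue G = graph_eigenvalue H"
    using graph_eigenvalue_transport[of \<phi> G H] \<phi> arcs by (intro ext iffI) auto
  moreover have "finite (pverts H)" using fin \<phi> by (simp add: bij_betw_finite)
  ultimately show ?thesis
    using fin by (simp add: graph_spectral_radius_def spectrum_adjacency_matrix)
qed

section \<open>Dissociation sets and the extremal graph\<close>

text \<open>Adjacency in the complement, made false outside \<open>pverts G\<close> because the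
  relation of \<open>wheel_free\<close> lives on the whole type.\<close>

definition nonadjacent :: "'a pair_pre_digraph \<Rightarrow> 'a \<Rightarrow> 'a \<Rightarrow> bool" where
  "nonadjacent G x y \<longleftrightarrow> x \<in> pverts G \<and> y \<in> pverts G \<and> x \<noteq> y \<and> (x, y) \<notin> parcs G"

lemma out_degree_induced:
  assumes "v \<in> S"
  shows "out_degree (with_proj G \<restriction> S) v = card {w \<in> S. (v, w) \<in> parcs G}"
proof -
  have "out_arcs (with_proj G \<restriction> S) v = Pair v ` {w \<in> S. (v, w) \<in> parcs G}"
    using assms by (auto simp: out_arcs_def)
  then show ?thesis by (simp add: out_degree_def card_image inj_on_def)
qed

lemma finite_dissociation_sets: "finite (pverts G) \<Longrightarrow> finite {S. dissociation_set G S}"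
  by (rule finite_subset[of _ "Pow (pverts G)"]) (auto simp: dissociation_set_def)

lemma card_le_dissociation_number:
  assumes "finite (pverts G)" "dissociation_set G S"
  shows "card S \<le> dissociation_number G"
  unfolding dissociation_number_def
  using assms finite_dissociation_sets[of G] by (intro Max_ge) auto

lemma pair_graph_sym: "pair_graph G \<Longrightarrow> (x, y) \<in> parcs G \<Longrightarrow> (y, x) \<in> parcs G"
proof -
  assume "pair_graph G" and e: "(x, y) \<in> parcs G"
  then interpret pair_graph G by simp
  show "(y, x) \<in> parcs G" using arcs_symmetric e by simp
qed

text \<open>Among the five vertices of a wheel, only the opposite rim pairs \<open>x1\<close>,
  \<open>x3\<close> and \<open>x2\<close>, \<open>x4\<close> can be joined in \<open>G\<close>, so
  all induced degrees are at most 1.\<close>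

lemma wheel_free_nonadjacent:
  assumes G: "pair_graph G" and diss: "dissociation_number G \<le> 4"
  shows "wheel_free (nonadjacent G)"
proof
  interpret pair_graph G by fact
  show "nonadjacent G y x" if "nonadjacent G x y" for x y
    using that pair_graph_sym[OF G] by (auto simp: nonadjacent_def)
  show "\<not> nonadjacent G x x" for x by (simp add: nonadjacent_def)
  fix c x1 x2 x3 x4
  assume c: "nonadjacent G c x1" "nonadjacent G c x2" "nonadjacent G c x3" "nonadjacent G c x4"
    and x: "nonadjacent G x1 x2" "nonadjacent G x2 x3" "nonadjacent G x3 x4" "nonadjacent G x4 x1"
    and ne: "x1 \<noteq> x3" "x2 \<noteq> x4"
  let ?S = "{c, x1, x2, x3, x4}"
  have non: "(u, v) \<notin> parcs G \<and> (v, u) \<notin> parcs G" if "nonadjacent G u v" for u v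
    using that pair_graph_sym[OF G] by (auto simp: nonadjacent_def)
  note nons = non[OF c(1)] non[OF c(2)] non[OF c(3)] non[OF c(4)] non[OF x(1)] non[OF x(2)] non[OF x(3)] non[OF x(4)]
  have loop: "(v, v) \<notin> parcs G" for v using no_loops' by blast
  have "\<exists>u. {w \<in> ?S. (v, w) \<in> parcs G} \<subseteq> {u}" if "v \<in> ?S" for v
  proof -
    consider "v = c" | "v = x1" | "v = x2" | "v = x3" | "v = x4" using \<open>v \<in> ?S\<close> by blast
    then show ?thesis
    proof cases
      case 1
      then have "{w \<in> ?S. (v, w) \<in> parcs G} \<subseteq> {c}" using nons loop by auto
      then show ?thesis by (rule exI)
    next
      case 2
      then have "{w \<in> ?S. (v, w) \<in> parcs G} \<subseteq> {x3}" using nons loop by auto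
      then show ?thesis by (rule exI)
    next
      case 3
      then have "{w \<in> ?S. (v, w) \<in> parcs G} \<subseteq> {x4}" using nons loop by auto
      then show ?thesis by (rule exI)
    next
      case 4
      then have "{w \<in> ?S. (v, w) \<in> parcs G} \<subseteq> {x1}" using nons loop by auto
      then show ?thesis by (rule exI)
    next
      case 5
      then have "{w \<in> ?S. (v, w) \<in> parcs G} \<subseteq> {x2}" using nons loop by auto
      then show ?thesis by (rule exI)
    qed
  qed
  then have "card {w \<in> ?S. (v, w) \<in> parcs G} \<le> 1" if v: "v \<in> ?S" for v
  proof -
    obtain u where "{w \<in> ?S. (v, w) \<in> parcs G} \<subseteq> {u}" using \<open>\<And>v. v \<in> ?S \<Longrightarrow> _\<close>[OF v] by (rule exE)
    then have "card {w \<in> ?S. (v, w) \<in> parcs G} \<le> card {u}" by (intro card_mono) auto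
    then show ?thesis by simp
  qed
  then have "dissociation_set G ?S"
    using c x by (auto simp: dissociation_set_def out_degree_induced nonadjacent_def simp del: One_nat_def)
  moreover have "distinct [c, x1, x2, x3, x4]" using c x ne by (auto simp: nonadjacent_def)
  then have "card ?S = 5" by simp
  ultimately show False
    using card_le_dissociation_number[of G ?S] pair_finite_verts diss by simp
qed

lemma arcs_nonadjacent:
  assumes G: "pair_graph G" and wf: "wheel_free (nonadjacent G)"
  shows "wheel_free.arcs (nonadjacent G) (pverts G) + card (parcs G) + card (pverts G) = card (pverts G) * card (pverts G)"
proof -
  interpret pair_graph G by fact
  let ?V = "pverts G"
  have fin: "finite ?V" by (rule pair_finite_verts)
  have "parcs G \<subseteq> ?V \<times> ?V" using in_arcsD1 in_arcsD2 by auto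
  then have "(\<Sum>p\<in>?V \<times> ?V. of_bool (p \<in> parcs G) :: nat) = card (parcs G)"
    using fin by (simp add: Int_absorb1)
  then have E: "(\<Sum>x\<in>?V. \<Sum>y\<in>?V. of_bool ((x, y) \<in> parcs G) :: nat) = card (parcs G)"
    by (simp add: sum.cartesian_product case_prod_beta del: sum_of_bool_eq)
  have D: "(\<Sum>x\<in>?V. \<Sum>y\<in>?V. of_bool (x = y) :: nat) = card ?V"
    using fin by (simp add: of_bool_def)
  have "(\<Sum>x\<in>?V. \<Sum>y\<in>?V. of_bool (nonadjacent G x y) + of_bool ((x, y) \<in> parcs G) + of_bool (x = y))
      = (\<Sum>x\<in>?V. \<Sum>y\<in>?V. 1 :: nat)"
    using no_loops' by (intro sum.cong refl) (auto simp: nonadjacent_def)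
  then show ?thesis
    using E D unfolding wheel_free.arcs_def[OF wf] wheel_free.deg_def[OF wf] sum.distrib by simp
qed

lemma connected_cross_arc:
  assumes conn: "Digraph_Component.connected (with_proj G)"
    and AB: "A \<union> B = pverts G" "A \<noteq> {}" "B \<noteq> {}" "A \<inter> B = {}"
  shows "\<exists>a\<in>A. \<exists>b\<in>B. (a, b) \<in> parcs G \<or> (b, a) \<in> parcs G"
proof (rule ccontr)
  assume no: "\<not> ?thesis"
  obtain a b where ab: "a \<in> A" "b \<in> B" using AB by blast
  have "(a, b) \<in> rtrancl_on (pverts G) ((parcs G)\<^sup>s)"
    using conn ab AB(1) unfolding connected_conv by auto
  then have "b \<in> A"
  proof (induction rule: rtrancl_on_induct)
    case base
    then show ?case using ab by simp
  next
    case (step y z)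
    have "(y, z) \<in> parcs G \<or> (z, y) \<in> parcs G" using step(2) by (auto simp: symcl_def)
    then show ?case using step(4,5) no AB(1) by blast
  qed
  then show False using ab AB(4) by blast
qed

lemma digraph_isoI:
  assumes G: "pair_graph G" and \<phi>: "bij_betw \<phi> (pverts G) (pverts H)"
    and arcs: "\<And>u v. u \<in> pverts G \<Longrightarrow> v \<in> pverts G \<Longrightarrow> (u, v) \<in> parcs G \<longleftrightarrow> (\<phi> u, \<phi> v) \<in> parcs H"
    and H: "parcs H \<subseteq> pverts H \<times> pverts H"
  shows "digraph_iso (with_proj G) (with_proj H)"
proof -
  interpret pair_graph G by fact
  have sub: "parcs G \<subseteq> pverts G \<times> pverts G" using in_arcsD1 in_arcsD2 by auto
  have inj: "inj_on \<phi> (pverts G)" and img: "\<phi> ` pverts G = pverts H" using \<phi> by (auto simp: bij_betw_def)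
  define F where "F = \<lparr>iso_verts = \<phi>, iso_arcs = map_prod \<phi> \<phi>, iso_head = snd, iso_tail = fst\<rparr>"
  have "inj_on (map_prod \<phi> \<phi>) (parcs G)"
    by (rule inj_on_subset[OF map_prod_inj_on[OF inj inj] sub])
  then have "pre_digraph.digraph_isomorphism (with_proj G) F"
    unfolding pre_digraph.digraph_isomorphism_def using inj wf_digraph_axioms by (auto simp: F_def)
  moreover have "map_prod \<phi> \<phi> ` parcs G = parcs H"
  proof
    show "map_prod \<phi> \<phi> ` parcs G \<subseteq> parcs H" using arcs sub by auto
    show "parcs H \<subseteq> map_prod \<phi> \<phi> ` parcs G"
    proof
      fix e assume e: "e \<in> parcs H"
      then obtain u v where "u \<in> pverts G" "v \<in> pverts G" "e = (\<phi> u, \<phi> v)"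
        using H img by (cases e) blast
      then show "e \<in> map_prod \<phi> \<phi> ` parcs G" using arcs[of u v] e by force
    qed
  qed
  then have "with_proj H = app_iso F (with_proj G)"
    using img by (simp add: app_iso_def F_def with_proj_def)
  ultimately show ?thesis unfolding digraph_iso_def by blast
qed

text \<open>Matched vertices receive labels \<open>2 * i\<close> and \<open>2 * i + 1\<close>, the
  pairs left unjoined in \<open>CP\<close>. A prescribed vertex \<open>a\<close> gets 0, the end of
  the bridge in \<open>T_hat\<close>; the premise \<open>a \<in> A\<close> lets the induction
  hypothesis be instantiated with the already removed \<open>u\<close>.\<close>

lemma (in wheel_free) perfect_matching_labelling:
  assumes "finite A" "card A = 2 * k" "matching A" "\<And>x. x \<in> A \<Longrightarrow> \<exists>y\<in>A. h x y"
  shows "\<exists>f. bij_betw f A {0..<2 * k} \<and> (a \<in> A \<longrightarrow> f a = (0 :: nat)) \<and>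
    (\<forall>x\<in>A. \<forall>y\<in>A. x \<noteq> y \<longrightarrow> (h x y \<longleftrightarrow> f x div 2 = f y div 2))"
  using assms
proof (induction k arbitrary: A a)
  case 0
  then show ?case by (auto simp: bij_betw_def)
next
  case (Suc k A a)
  have "A \<noteq> {}" using Suc.prems(2) by auto
  then obtain u where u: "u \<in> A" "a \<in> A \<longrightarrow> u = a" by blast
  obtain v where v: "v \<in> A" "h u v" using Suc.prems(4)[OF u(1)] by blast
  have uv: "u \<noteq> v" "h v u" using v irrefl sym by auto
  let ?B = "A - {u, v}"
  have onlyu: "y = v" if "h u y" "y \<in> A" for y using matchingD[OF Suc.prems(3) that(1) v(2) u(1) that(2) v(1)] .
  have onlyv: "y = u" if "h v y" "y \<in> A" for y using matchingD[OF Suc.prems(3) that(1) uv(2) v(1) that(2) u(1)] .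
  have "card ?B = 2 * k" using Suc.prems(1,2) u v uv by (simp add: card_Diff_subset)
  moreover have "matching ?B" using Suc.prems(3) unfolding matching_def by blast
  moreover have "\<exists>y\<in>?B. h x y" if x: "x \<in> ?B" for x
  proof -
    obtain y where y: "y \<in> A" "h x y" using Suc.prems(4)[of x] x by blast
    have "y \<noteq> u" "y \<noteq> v" using onlyu[of x] onlyv[of x] sym[OF y(2)] x by auto
    then show ?thesis using y by blast
  qed
  ultimately obtain f where f: "bij_betw f ?B {0..<2 * k}"
    "\<And>x y. x \<in> ?B \<Longrightarrow> y \<in> ?B \<Longrightarrow> x \<noteq> y \<Longrightarrow> h x y \<longleftrightarrow> f x div 2 = f y div 2"
    using Suc.IH[of ?B u] Suc.prems(1) by auto
  \<comment> \<open>The removed pair takes the labels 0 and 1, and all others move up by one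
    pair.\<close>
  define g where "g x = (if x = u then 0 else if x = v then 1 else f x + 2)" for x
  have gB: "g x = f x + 2" if "x \<in> ?B" for x using that by (auto simp: g_def)
  have "bij_betw (\<lambda>i. i + 2) {0..<2 * k} ((\<lambda>i. i + 2) ` {0..<2 * k})"
    by (intro inj_on_imp_bij_betw inj_onI) simp
  then have "bij_betw ((\<lambda>i. i + 2) \<circ> f) ?B ((\<lambda>i. i + 2) ` {0..<2 * k})"
    by (rule bij_betw_trans[OF f(1)])
  then have "bij_betw g ?B ((\<lambda>i. i + 2) ` {0..<2 * k})"
    using bij_betw_cong[of ?B g "(\<lambda>i. i + 2) \<circ> f"] gB by simp
  moreover have "bij_betw g {u, v} {0, 1}" using uv by (auto simp: bij_betw_def g_def)
  ultimately have "bij_betw g (?B \<union> {u, v}) ((\<lambda>i. i + 2) ` {0..<2 * k} \<union> {0, 1})"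
    by (rule bij_betw_combine) auto
  moreover have "?B \<union> {u, v} = A" using u v by blast
  moreover have "(\<lambda>i. i + 2) ` {0..<2 * k} \<union> {0, 1} = {0..<2 * Suc k}"
    unfolding image_add_atLeastLessThan' by auto
  ultimately have "bij_betw g A {0..<2 * Suc k}" by simp
  moreover have "g a = 0" if "a \<in> A" using u(2) that by (simp add: g_def)
  moreover have "h x y \<longleftrightarrow> g x div 2 = g y div 2" if xy: "x \<in> A" "y \<in> A" "x \<noteq> y" for x y
  proof -
    have gu: "g u div 2 = 0" "g v div 2 = 0" using uv by (auto simp: g_def)
    have gpos: "g z div 2 \<noteq> 0" if "z \<in> ?B" for z using gB[OF that] by simp
    consider "x \<in> ?B" "y \<in> ?B" | "x = u" | "x = v" | "x \<in> ?B" "y = u" | "x \<in> ?B" "y = v" using xy by blast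
    then show ?thesis
    proof cases
      case 1
      then show ?thesis using f(2)[OF 1 xy(3)] gB by simp
    next
      case 2
      then show ?thesis using onlyu[of y] v gu gpos[of y] xy by (cases "y = v") auto
    next
      case 3
      then show ?thesis using onlyv[of y] uv gu gpos[of y] xy by (cases "y = u") auto
    next
      case 4
      then have "\<not> h x y" using onlyu[of x] sym[of x u] by auto
      then show ?thesis using 4 gu gpos[of x] by auto
    next
      case 5
      then have "\<not> h x y" using onlyv[of x] sym[of x v] by auto
      then show ?thesis using 5 gu gpos[of x] by auto
    qed
  qed
  ultimately show ?case by blast
qed

section \<open>The graph \<open>T_hat (4 * k)\<close>\<close>

lemma
  assumes "k \<ge> 1"
  shows pverts_T_hat: "pverts (T_hat (4 * k)) = {0..<2 * k} <+> {0..<2 * k}"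
    and parcs_T_hat: "(Inl i, Inl j) \<in> parcs (T_hat (4 * k)) \<longleftrightarrow> i < 2 * k \<and> j < 2 * k \<and> i div 2 \<noteq> j div 2"
      "(Inr i, Inr j) \<in> parcs (T_hat (4 * k)) \<longleftrightarrow> i < 2 * k \<and> j < 2 * k \<and> i div 2 \<noteq> j div 2"
      "(Inl i, Inr j) \<in> parcs (T_hat (4 * k)) \<longleftrightarrow> i = 0 \<and> j = 0"
      "(Inr i, Inl j) \<in> parcs (T_hat (4 * k)) \<longleftrightarrow> i = 0 \<and> j = 0"
proof -
  have part: "part (4 * k div 2) = CP (2 * k)" "part (4 * k - 4 * k div 2) = CP (2 * k)"
    by (simp_all add: part_def)
  have CP: "(i, j) \<in> parcs (CP (2 * k)) \<longleftrightarrow> i < 2 * k \<and> j < 2 * k \<and> i div 2 \<noteq> j div 2" for i j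
    by (auto simp: CP_def complete_graph_def)
  show "pverts (T_hat (4 * k)) = {0..<2 * k} <+> {0..<2 * k}"
    unfolding T_hat_def part Let_def by (simp add: CP_def)
  show "(Inl i, Inl j) \<in> parcs (T_hat (4 * k)) \<longleftrightarrow> i < 2 * k \<and> j < 2 * k \<and> i div 2 \<noteq> j div 2"
    "(Inr i, Inr j) \<in> parcs (T_hat (4 * k)) \<longleftrightarrow> i < 2 * k \<and> j < 2 * k \<and> i div 2 \<noteq> j div 2"
    "(Inl i, Inr j) \<in> parcs (T_hat (4 * k)) \<longleftrightarrow> i = 0 \<and> j = 0"
    "(Inr i, Inl j) \<in> parcs (T_hat (4 * k)) \<longleftrightarrow> i = 0 \<and> j = 0"
    unfolding T_hat_def part Let_def CP[symmetric] by force+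
qed

lemma parcs_T_hat_subset: "k \<ge> 1 \<Longrightarrow> parcs (T_hat (4 * k)) \<subseteq> pverts (T_hat (4 * k)) \<times> pverts (T_hat (4 * k))"
proof
  fix e assume k: "k \<ge> 1" and e: "e \<in> parcs (T_hat (4 * k))"
  obtain u v where uv: "e = (u, v)" by (cases e)
  show "e \<in> pverts (T_hat (4 * k)) \<times> pverts (T_hat (4 * k))"
    using e k unfolding uv pverts_T_hat[OF k]
    by (cases u; cases v) (auto simp: parcs_T_hat[OF k])
qed

lemma pair_graph_T_hat:
  assumes k: "k \<ge> 1"
  shows "pair_graph (T_hat (4 * k))"
proof -
  note sub = parcs_T_hat_subset[OF k]
  have fin: "finite (pverts (T_hat (4 * k)))" by (simp add: pverts_T_hat[OF k])
  have sym: "(v, u) \<in> parcs (T_hat (4 * k))" if "(u, v) \<in> parcs (T_hat (4 * k))" for u v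
    using that by (cases u; cases v) (auto simp: parcs_T_hat[OF k])
  have loop: "(u, u) \<notin> parcs (T_hat (4 * k))" for u
    by (cases u) (auto simp: parcs_T_hat[OF k])
  show ?thesis
  proof
    show "fst e \<in> pverts (T_hat (4 * k))" "snd e \<in> pverts (T_hat (4 * k))"
      if "e \<in> parcs (T_hat (4 * k))" for e
      using that sub by auto
    show "finite (parcs (T_hat (4 * k)))" using finite_subset[OF sub] fin by simp
    show "fst e \<noteq> snd e" if "e \<in> parcs (T_hat (4 * k))" for e
      using that loop by (cases e) auto
    show "symmetric (with_proj (T_hat (4 * k)))"
      unfolding symmetric_def with_proj_simps by (rule symI) (rule sym)
  qed (rule fin)
qed

text \<open>All vertices are linked to the root \<open>Inl 0\<close>. Inside a half, 0 and its
  non-neighbour 1 communicate through 2, which exists because \<open>k \<ge> 2\<close>.\<close>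

lemma connected_T_hat:
  assumes k: "k \<ge> 2"
  shows "Digraph_Component.connected (with_proj (T_hat (4 * k)))"
proof -
  have k1: "k \<ge> 1" using k by simp
  let ?V = "pverts (T_hat (4 * k))" and ?E = "(parcs (T_hat (4 * k)))\<^sup>s"
  interpret pair_graph "T_hat (4 * k)" by (rule pair_graph_T_hat[OF k1])
  have edge: "(u, v) \<in> rtrancl_on ?V ?E" if "(u, v) \<in> parcs (T_hat (4 * k))" for u v
    using that parcs_T_hat_subset[OF k1] rtrancl_on_into_rtrancl_on[of u u ?V ?E v] rtrancl_on_refl[of u ?V ?E]
    by (auto simp: symcl_def)
  have edge': "(v, u) \<in> rtrancl_on ?V ?E" if "(u, v) \<in> parcs (T_hat (4 * k))" for u v
    using edge pair_graph_sym[OF pair_graph_T_hat[OF k1] that] by blast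
  note tr = rtrancl_on_trans
  have ll: "(Inl i, Inl j) \<in> rtrancl_on ?V ?E" if "i div 2 \<noteq> j div 2" "i < 2 * k" "j < 2 * k" for i j
    using that by (intro edge) (simp add: parcs_T_hat[OF k1])
  have rr: "(Inr i, Inr j) \<in> rtrancl_on ?V ?E" if "i div 2 \<noteq> j div 2" "i < 2 * k" "j < 2 * k" for i j
    using that by (intro edge) (simp add: parcs_T_hat[OF k1])
  have l: "(Inl i, Inl 0) \<in> rtrancl_on ?V ?E \<and> (Inl 0, Inl i) \<in> rtrancl_on ?V ?E" if i: "i < 2 * k" for i
  proof (cases "i div 2 = 0")
    case True
    then show ?thesis using tr[OF ll[of i 2] ll[of 2 0]] tr[OF ll[of 0 2] ll[of 2 i]] i k by simp
  next
    case False
    then show ?thesis using ll[of i 0] ll[of 0 i] i k by simp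
  qed
  have r: "(Inr i, Inr 0) \<in> rtrancl_on ?V ?E \<and> (Inr 0, Inr i) \<in> rtrancl_on ?V ?E" if i: "i < 2 * k" for i
  proof (cases "i div 2 = 0")
    case True
    then show ?thesis using tr[OF rr[of i 2] rr[of 2 0]] tr[OF rr[of 0 2] rr[of 2 i]] i k by simp
  next
    case False
    then show ?thesis using rr[of i 0] rr[of 0 i] i k by simp
  qed
  have lr: "(Inl 0, Inr 0) \<in> rtrancl_on ?V ?E" "(Inr 0, Inl 0) \<in> rtrancl_on ?V ?E"
    by (intro edge; simp add: parcs_T_hat[OF k1])+
  have root: "(u, Inl 0) \<in> rtrancl_on ?V ?E \<and> (Inl 0, u) \<in> rtrancl_on ?V ?E" if "u \<in> ?V" for u
  proof (cases u)
    case (Inl i)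
    then show ?thesis using l[of i] that by (auto simp: pverts_T_hat[OF k1])
  next
    case (Inr i)
    then show ?thesis using tr[OF _ lr(2), of u] tr[OF lr(1), of u] r[of i] that by (auto simp: pverts_T_hat[OF k1])
  qed
  have "Inl 0 \<in> ?V" using k by (simp add: pverts_T_hat[OF k1] Plus_def)
  then show ?thesis
    unfolding connected_conv with_proj_simps
  proof (intro conjI ballI)
    fix u v assume "u \<in> ?V" "v \<in> ?V"
    then show "(u, v) \<in> rtrancl_on ?V ?E" by (intro tr[OF conjunct1[OF root] conjunct2[OF root]])
  qed blast
qed

text \<open>A pair \<open>{2 * m, 2 * m + 1}\<close> cannot hold three numbers, so one of three lies
  in a pair with neither of the others. In \<open>CP\<close> it is adjacent to both, which caps a
  dissociation set at two vertices per half.\<close>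

lemma three_elements_separated:
  fixes S :: "nat set"
  assumes "card S \<ge> 3"
  obtains l i j where "l \<in> S" "i \<in> S" "j \<in> S" "i \<noteq> j" "l div 2 \<noteq> i div 2" "l div 2 \<noteq> j div 2"
proof -
  obtain R where "R \<subseteq> S" "card R = 3" using obtain_subset_with_card_n[OF assms] by blast
  then obtain a b c where "a \<in> S" "b \<in> S" "c \<in> S" "a \<noteq> b" "a \<noteq> c" "b \<noteq> c"
    unfolding card_3_iff by auto
  moreover have "(p \<noteq> q \<and> p \<noteq> r) \<or> (q \<noteq> p \<and> q \<noteq> r) \<or> (r \<noteq> p \<and> r \<noteq> q)"
    if "\<not> (p = q \<and> p = r)" for p q r :: nat
    using that by blast
  moreover have "\<not> (a div 2 = b div 2 \<and> a div 2 = c div 2)"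
  proof
    assume eq: "a div 2 = b div 2 \<and> a div 2 = c div 2"
    have half: "x \<in> {2 * (x div 2), 2 * (x div 2) + 1}" for x :: nat by auto
    have "{a, b, c} \<subseteq> {2 * (a div 2), 2 * (a div 2) + 1}"
      using half[of a] half[of b] half[of c] unfolding eq[THEN conjunct1, symmetric] eq[THEN conjunct2, symmetric] by blast
    then have "card {a, b, c} \<le> card {2 * (a div 2), 2 * (a div 2) + 1}" by (intro card_mono) simp
    then show False using \<open>a \<noteq> b\<close> \<open>a \<noteq> c\<close> \<open>b \<noteq> c\<close> by simp
  qed
  ultimately show thesis using that[of a b c] that[of b a c] that[of c a b] by blast
qed

lemma dissociation_number_T_hat:
  assumes k: "k \<ge> 2"
  shows "dissociation_number (T_hat (4 * k)) = 4"
proof -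
  have k1: "k \<ge> 1" using k by simp
  let ?G = "T_hat (4 * k)"
  have fin: "finite (pverts ?G)" by (simp add: pverts_T_hat[OF k1])
  have le: "card S \<le> 4" if S: "dissociation_set ?G S" for S
  proof -
    have sub: "S \<subseteq> pverts ?G" using S by (simp add: dissociation_set_def)
    then have finS: "finite S" using fin finite_subset by blast
    have one: "x = y" if "v \<in> S" "x \<in> S" "y \<in> S" "(v, x) \<in> parcs ?G" "(v, y) \<in> parcs ?G" for v x y
    proof -
      have "card {w \<in> S. (v, w) \<in> parcs ?G} \<le> Suc 0"
        using S that(1) out_degree_induced[OF that(1), of ?G] by (auto simp: dissociation_set_def)
      then show ?thesis using finS that by (subst (asm) card_le_Suc0_iff_eq) auto
    qed
    have bound: "card (Inl -` S) \<le> 2"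
    proof (rule ccontr)
      assume "\<not> ?thesis"
      then have "card (Inl -` S) \<ge> 3" by simp
      then obtain l i j where "l \<in> Inl -` S" "i \<in> Inl -` S" "j \<in> Inl -` S" "i \<noteq> j"
        "l div 2 \<noteq> i div 2" "l div 2 \<noteq> j div 2" by (rule three_elements_separated)
      moreover from this have "l < 2 * k" "i < 2 * k" "j < 2 * k"
        using sub by (auto simp: pverts_T_hat[OF k1])
      ultimately show False
        using one[of "Inl l" "Inl i" "Inl j"] by (auto simp: parcs_T_hat[OF k1])
    qed
    moreover have "card (Inr -` S) \<le> 2"
    proof (rule ccontr)
      assume "\<not> ?thesis"
      then have "card (Inr -` S) \<ge> 3" by simp
      then obtain l i j where "l \<in> Inr -` S" "i \<in> Inr -` S" "j \<in> Inr -` S" "i \<noteq> j"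
        "l div 2 \<noteq> i div 2" "l div 2 \<noteq> j div 2" by (rule three_elements_separated)
      moreover from this have "l < 2 * k" "i < 2 * k" "j < 2 * k"
        using sub by (auto simp: pverts_T_hat[OF k1])
      ultimately show False
        using one[of "Inr l" "Inr i" "Inr j"] by (auto simp: parcs_T_hat[OF k1])
    qed
    moreover have "S = (Inl -` S) <+> (Inr -` S)"
    proof (rule Set.set_eqI)
      show "u \<in> S \<longleftrightarrow> u \<in> (Inl -` S) <+> (Inr -` S)" for u by (cases u) auto
    qed
    moreover have "finite (Inl -` S)" "finite (Inr -` S)"
      using finS by (auto intro: finite_vimageI)
    ultimately show ?thesis using card_Plus[of "Inl -` S" "Inr -` S"] by simp
  qed
  \<comment> \<open>A nonadjacent pair from each half, away from the bridge ends labelled 0, gives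
    an independent set.\<close>
  define S where "S = {2, 3 :: nat} <+> {2, 3 :: nat}"
  have empty: "{w \<in> S. (v, w) \<in> parcs ?G} = {}" if "v \<in> S" for v
    using that by (auto simp: S_def parcs_T_hat[OF k1])
  have "S \<subseteq> pverts ?G" using k by (auto simp: S_def pverts_T_hat[OF k1])
  moreover have "out_degree (with_proj ?G \<restriction> S) v \<le> 1" if "v \<in> S" for v
    unfolding out_degree_induced[OF that] empty[OF that] by simp
  ultimately have diss: "dissociation_set ?G S" by (simp add: dissociation_set_def)
  moreover have "card S = 4" by (simp add: S_def card_Plus)
  ultimately have "4 \<le> dissociation_number ?G"
    using card_le_dissociation_number[OF fin, of S] by simp
  moreover have "dissociation_number ?G \<le> 4"
    unfolding dissociation_number_def using finite_dissociation_sets[OF fin] le diss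
    by (subst Max_le_iff) auto
  ultimately show ?thesis by simp
qed

lemma T_hat_connected_graphs:
  assumes "k \<ge> 2"
  shows "T_hat (4 * k) \<in> connected_graphs (4 * k) 4"
  using assms pair_graph_T_hat[of k] connected_T_hat[of k] dissociation_number_T_hat[of k]
  by (simp add: connected_graphs_def pverts_T_hat card_Plus)

text \<open>The average degree of \<open>T_hat (4 * k)\<close> is
  \<open>2 * k - 2 + 1 / (2 * k)\<close>, so there is a margin of \<open>1 / (2 * k)\<close> in
  which a nearly constant test vector suffices.\<close>

lemma spectral_radius_T_hat_less:
  assumes k: "k \<ge> 2"
  shows "graph_spectral_radius (T_hat (4 * k)) < 2 * real k - 2 + 1 / real k"
proof -
  have k1: "k \<ge> 1" using k by simp
  let ?G = "T_hat (4 * k)"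
  \<comment> \<open>Let the bridge ends have weight \<open>1 + c / k\<close> and all other vertices
    weight 1. The neighbours of a bridge end within its half require \<open>c < 1\<close>. At the
    bridge ends the slack is \<open>(1 - x) * (2 * c - 1 - c * x)\<close> with
    \<open>x = 1 / k\<close>, which is positive for all \<open>x \<le> 1 / 2\<close> once
    \<open>c > 2 / 3\<close>. The choice \<open>c = 3 / 4\<close> meets both conditions.\<close>
  define a :: real where "a = 1 + 3 / (4 * k)"
  define \<theta> :: real where "\<theta> = 2 * real k - 2 + 1 / real k"
  define q :: "nat \<Rightarrow> real" where "q i = (if i = 0 then a else 1)" for i
  define p :: "nat + nat \<Rightarrow> real" where "p = case_sum q q"
  have kr: "real k \<ge> 2" using k by simp
  have total: "(\<Sum>j = 0..<2 * k. q j) = a + 2 * k - 1"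
  proof -
    have "(\<Sum>j = 0..<2 * k. q j) = q 0 + (\<Sum>j = Suc 0..<2 * k. q j)"
      using k by (intro sum.atLeast_Suc_lessThan) simp
    also have "(\<Sum>j = Suc 0..<2 * k. q j) = (\<Sum>j = Suc 0..<2 * k. 1)"
      by (intro sum.cong) (auto simp: q_def)
    finally show ?thesis using k by (simp add: q_def)
  qed
  have row: "(\<Sum>j = 0..<2 * k. of_bool (i div 2 \<noteq> j div 2) * q j) = a + 2 * k - 1 - (if i div 2 = 0 then a + 1 else 2)"
    if i: "i < 2 * k" for i
  proof -
    let ?B = "{2 * (i div 2), 2 * (i div 2) + 1}"
    have "i div 2 < k" using i by (intro less_mult_imp_div_less) (simp add: mult.commute)
    then have B: "{j \<in> {0..<2 * k}. i div 2 = j div 2} = ?B" by auto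
    have "(\<Sum>j = 0..<2 * k. of_bool (i div 2 \<noteq> j div 2) * q j) + (\<Sum>j = 0..<2 * k. if i div 2 = j div 2 then q j else 0)
        = (\<Sum>j = 0..<2 * k. q j)"
      unfolding sum.distrib[symmetric] by (intro sum.cong) auto
    moreover have "(\<Sum>j = 0..<2 * k. if i div 2 = j div 2 then q j else 0) = (\<Sum>j\<in>?B. q j)"
      unfolding B[symmetric] by (rule sum.inter_filter[symmetric]) simp
    moreover have "(\<Sum>j\<in>?B. q j) = (if i div 2 = 0 then a + 1 else 2)" by (auto simp: q_def)
    ultimately show ?thesis using total by simp
  qed
  have zero: "(\<Sum>j = 0..<2 * k. of_bool (i = 0 \<and> j = 0) * q j) = (if i = 0 then a else 0)" for i :: nat
  proof -
    have "(\<Sum>j = 0..<2 * k. of_bool (i = 0 \<and> j = 0) * q j) = (\<Sum>j = 0..<2 * k. if j = 0 then (if i = 0 then a else 0) else 0)"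
      by (intro sum.cong) (auto simp: q_def)
    then show ?thesis using k by (simp add: sum.delta)
  qed
  have a: "a > 1" using k by (simp add: a_def)
  have ineq: "a + 2 * k - 1 - (if i div 2 = 0 then a + 1 else 2) + (if i = 0 then a else 0) < \<theta> * q i" for i :: nat
  proof -
    have "2 * real k - 2 + a < \<theta> * a"
    proof -
      define x :: real where "x = 1 / k"
      have x: "0 < x" "x \<le> 1 / 2" "k * x = 1" using kr by (auto simp: x_def field_simps)
      have eqs: "a = 1 + 3 / 4 * x" "\<theta> = 2 * real k - 2 + x" by (simp_all add: a_def \<theta>_def x_def)
      have "\<theta> * a - (2 * real k - 2 + a) = (2 * real k - 3 + x) * (1 + 3 / 4 * x) - (2 * real k - 2)"
        unfolding eqs by (simp add: algebra_simps)
      also have "\<dots> = - 1 + 3 / 2 * (real k * x) - 5 / 4 * x + 3 / 4 * x * x"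
        by (simp add: algebra_simps)
      also have "\<dots> = (1 - x) * (2 - 3 * x) / 4" unfolding x(3) by (simp add: field_simps)
      also have "\<dots> > 0" using x by simp
      finally show ?thesis by simp
    qed
    moreover have "2 * real k - 2 < \<theta>" "a + 2 * real k - 3 < \<theta>"
      using kr by (auto simp: \<theta>_def a_def field_simps)
    ultimately show ?thesis by (auto simp: q_def)
  qed
  have "graph_spectral_radius ?G < \<theta>"
  proof (rule spectral_radius_less[of _ p])
    show "pair_graph ?G" by (rule pair_graph_T_hat[OF k1])
    show "pverts ?G \<noteq> {}" using k by (auto simp: pverts_T_hat[OF k1])
    show "p v > 0" if "v \<in> pverts ?G" for v using a by (cases v) (auto simp: p_def q_def)
    show "(\<Sum>w\<in>pverts ?G. of_bool ((v, w) \<in> parcs ?G) * p w) < \<theta> * p v" if v: "v \<in> pverts ?G" for v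
    proof -
      have split: "(\<Sum>w\<in>pverts ?G. of_bool ((v, w) \<in> parcs ?G) * p w)
        = (\<Sum>j = 0..<2 * k. of_bool ((v, Inl j) \<in> parcs ?G) * q j) + (\<Sum>j = 0..<2 * k. of_bool ((v, Inr j) \<in> parcs ?G) * q j)"
        unfolding pverts_T_hat[OF k1] by (subst sum.Plus) (simp_all add: p_def del: sum_of_bool_mult_eq sum_mult_of_bool_eq)
      show ?thesis
      proof (cases v)
        case (Inl i)
        then have i: "i < 2 * k" using v by (auto simp: pverts_T_hat[OF k1])
        have "(\<Sum>j = 0..<2 * k. of_bool ((v, Inl j) \<in> parcs ?G) * q j) = (\<Sum>j = 0..<2 * k. of_bool (i div 2 \<noteq> j div 2) * q j)"
          using i by (intro sum.cong) (auto simp: Inl parcs_T_hat[OF k1])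
        moreover have "(\<Sum>j = 0..<2 * k. of_bool ((v, Inr j) \<in> parcs ?G) * q j) = (\<Sum>j = 0..<2 * k. of_bool (i = 0 \<and> j = 0) * q j)"
          by (intro sum.cong) (auto simp: Inl parcs_T_hat[OF k1])
        ultimately show ?thesis using split row[OF i] zero[of i] ineq[of i] by (simp only: Inl p_def sum.case)
      next
        case (Inr i)
        then have i: "i < 2 * k" using v by (auto simp: pverts_T_hat[OF k1])
        have "(\<Sum>j = 0..<2 * k. of_bool ((v, Inr j) \<in> parcs ?G) * q j) = (\<Sum>j = 0..<2 * k. of_bool (i div 2 \<noteq> j div 2) * q j)"
          using i by (intro sum.cong) (auto simp: Inr parcs_T_hat[OF k1])
        moreover have "(\<Sum>j = 0..<2 * k. of_bool ((v, Inl j) \<in> parcs ?G) * q j) = (\<Sum>j = 0..<2 * k. of_bool (i = 0 \<and> j = 0) * q j)"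
          by (intro sum.cong) (auto simp: Inr parcs_T_hat[OF k1])
        ultimately show ?thesis using split row[OF i] zero[of i] ineq[of i] by (simp only: Inr p_def sum.case add.commute)
      qed
    qed
  qed
  then show ?thesis by (simp add: \<theta>_def)
qed

text \<open>Connectedness supplies an arc \<open>ab\<close> of \<open>G\<close> between the halves,
  that is, a missing cross pair of the complement. It exhausts the deficit, so it is the only such
  arc and both matchings are perfect; labelling \<open>a\<close> and \<open>b\<close> by 0 then
  reproduces \<open>T_hat (4 * k)\<close>.\<close>

lemma near_extremal_iso_T_hat:
  assumes wf: "wheel_free (nonadjacent G)" and G: "pair_graph G"
    and conn: "Digraph_Component.connected (with_proj G)" and k: "k \<ge> 1"
    and ext: "wheel_free.near_extremal (nonadjacent G) k A B" and AB: "A \<union> B = pverts G"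
  obtains \<phi> where "bij_betw \<phi> (pverts G) (pverts (T_hat (4 * k)))"
    "\<And>u v. u \<in> pverts G \<Longrightarrow> v \<in> pverts G \<Longrightarrow> (u, v) \<in> parcs G \<longleftrightarrow> (\<phi> u, \<phi> v) \<in> parcs (T_hat (4 * k))"
proof -
  interpret pair_graph G by fact
  interpret W: wheel_free "nonadjacent G" by fact
  have fin: "finite A" "finite B" and disj: "A \<inter> B = {}" and m: "W.matching A" "W.matching B"
    using ext by (auto simp: W.near_extremal_def)
  have card: "card A = 2 * k" "card B = 2 * k" using W.near_extremal_count[OF ext] by auto
  then have "A \<noteq> {}" "B \<noteq> {}" using k by auto
  then obtain a b where ab: "a \<in> A" "b \<in> B" "(a, b) \<in> parcs G"
    using connected_cross_arc[OF conn AB _ _ disj] pair_graph_sym[OF G] by blast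
  have adj: "(x, y) \<in> parcs G \<longleftrightarrow> x \<noteq> y \<and> \<not> nonadjacent G x y" if "x \<in> pverts G" "y \<in> pverts G" for x y
    using that no_loops' by (auto simp: nonadjacent_def)
  have nab: "\<not> nonadjacent G a b" "\<not> nonadjacent G b a"
    using ab pair_graph_sym[OF G] by (auto simp: nonadjacent_def)
  have cross: "(x, y) \<in> parcs G \<longleftrightarrow> x = a \<and> y = b" if xy: "x \<in> A" "y \<in> B" for x y
  proof
    assume "(x, y) \<in> parcs G"
    then have "\<not> nonadjacent G x y" by (simp add: nonadjacent_def)
    then show "x = a \<and> y = b" by (rule W.near_extremal_one_missing[OF ext ab(1,2) nab(1) xy])
  qed (use ab in simp)
  have "\<exists>y\<in>A. nonadjacent G x y" if "x \<in> A" for x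
    by (rule W.near_extremal_partner[OF ext ab(1,2) nab(1) that])
  then obtain f where f: "bij_betw f A {0..<2 * k}" "f a = (0 :: nat)"
    "\<And>x y. x \<in> A \<Longrightarrow> y \<in> A \<Longrightarrow> x \<noteq> y \<Longrightarrow> nonadjacent G x y \<longleftrightarrow> f x div 2 = f y div 2"
    using W.perfect_matching_labelling[OF fin(1) card(1) m(1), of a] ab(1) by auto
  have "\<exists>y\<in>B. nonadjacent G x y" if "x \<in> B" for x
    by (rule W.near_extremal_partner[OF W.near_extremal_sym[OF ext] ab(2,1) nab(2) that])
  then obtain g where g: "bij_betw g B {0..<2 * k}" "g b = (0 :: nat)"
    "\<And>x y. x \<in> B \<Longrightarrow> y \<in> B \<Longrightarrow> x \<noteq> y \<Longrightarrow> nonadjacent G x y \<longleftrightarrow> g x div 2 = g y div 2"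
    using W.perfect_matching_labelling[OF fin(2) card(2) m(2), of b] ab(2) by auto
  define \<phi> :: "'a \<Rightarrow> nat + nat" where "\<phi> x = (if x \<in> A then Inl (f x) else Inr (g x))" for x
  have \<phi>A: "\<phi> x = Inl (f x)" if "x \<in> A" for x using that by (simp add: \<phi>_def)
  have \<phi>B: "\<phi> x = Inr (g x)" if "x \<in> B" for x using that disj by (auto simp: \<phi>_def)
  have fA: "f x < 2 * k" if "x \<in> A" for x using bij_betwE[OF f(1)] that by auto
  have gB: "g x < 2 * k" if "x \<in> B" for x using bij_betwE[OF g(1)] that by auto
  have f0: "f x = 0 \<longleftrightarrow> x = a" if "x \<in> A" for x
    using inj_onD[OF bij_betw_imp_inj_on[OF f(1)] _ that ab(1)] f(2) by auto
  have g0: "g x = 0 \<longleftrightarrow> x = b" if "x \<in> B" for x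
    using inj_onD[OF bij_betw_imp_inj_on[OF g(1)] _ that ab(2)] g(2) by auto
  note T = parcs_T_hat[OF k]
  have "bij_betw \<phi> A (Inl ` {0..<2 * k})"
    using bij_betw_trans[OF f(1) inj_on_imp_bij_betw[of Inl]] bij_betw_cong[of A \<phi> "Inl \<circ> f"] \<phi>A by simp
  moreover have "bij_betw \<phi> B (Inr ` {0..<2 * k})"
    using bij_betw_trans[OF g(1) inj_on_imp_bij_betw[of Inr]] bij_betw_cong[of B \<phi> "Inr \<circ> g"] \<phi>B by simp
  ultimately have "bij_betw \<phi> (A \<union> B) (Inl ` {0..<2 * k} \<union> Inr ` {0..<2 * k})"
    by (rule bij_betw_combine) auto
  then have "bij_betw \<phi> (pverts G) (pverts (T_hat (4 * k)))"
    by (simp add: AB pverts_T_hat[OF k] Plus_def)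
  moreover have "(u, v) \<in> parcs G \<longleftrightarrow> (\<phi> u, \<phi> v) \<in> parcs (T_hat (4 * k))"
    if uv: "u \<in> pverts G" "v \<in> pverts G" for u v
  proof -
    consider "u \<in> A" "v \<in> A" | "u \<in> A" "v \<in> B" | "u \<in> B" "v \<in> A" | "u \<in> B" "v \<in> B"
      using uv AB by blast
    then show ?thesis
    proof cases
      case 1
      then show ?thesis using f(3)[OF 1] adj[OF uv] by (cases "u = v") (auto simp: \<phi>A T fA)
    next
      case 2
      show ?thesis
        unfolding cross[OF 2] \<phi>A[OF 2(1)] \<phi>B[OF 2(2)] T(3) f0[OF 2(1)] g0[OF 2(2)] by (rule refl)
    next
      case 3
      have "(u, v) \<in> parcs G \<longleftrightarrow> (v, u) \<in> parcs G" using pair_graph_sym[OF G] by blast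
      then show ?thesis
        unfolding cross[OF 3(2,1)] \<phi>A[OF 3(2)] \<phi>B[OF 3(1)] T(4) f0[OF 3(2)] g0[OF 3(1)] by blast
    next
      case 4
      then show ?thesis using g(3)[OF 4] adj[OF uv] by (cases "u = v") (auto simp: \<phi>B T gB)
    qed
  qed
  ultimately show thesis by (rule that)
qed

lemma connected_graphs_cases:
  assumes G: "G \<in> connected_graphs (4 * k) 4" and k: "k \<ge> 2"
  shows "graph_spectral_radius (T_hat (4 * k)) < graph_spectral_radius G \<or>
    graph_spectral_radius (T_hat (4 * k)) = graph_spectral_radius G \<and> digraph_iso (with_proj G) (with_proj (T_hat (4 * k)))"
proof -
  have pg: "pair_graph G" and conn: "Digraph_Component.connected (with_proj G)"
    and card: "card (pverts G) = 4 * k" and diss: "dissociation_number G = 4"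
    using G by (auto simp: connected_graphs_def)
  interpret pair_graph G by fact
  have fin: "finite (pverts G)" by (rule pair_finite_verts)
  have ne: "pverts G \<noteq> {}" using card k by auto
  have wf: "wheel_free (nonadjacent G)" using wheel_free_nonadjacent[OF pg] diss by simp
  interpret W: wheel_free "nonadjacent G" by (rule wf)
  show ?thesis
  \<comment> \<open>A deficit of at least 4 in the complement, rewritten for \<open>G\<close>
    without subtraction.\<close>
  proof (cases "card (parcs G) + 8 * k \<ge> 8 * k\<^sup>2 + 4")
    case True
    then have "real (8 * k\<^sup>2 + 4) \<le> real (card (parcs G) + 8 * k)" by (simp only: of_nat_le_iff)
    moreover have "(2 * real k - 2 + 1 / real k) * (4 * real k) = 8 * (real k)\<^sup>2 - 8 * real k + 4"
      using k by (simp add: field_simps power2_eq_square)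
    ultimately have "(2 * real k - 2 + 1 / real k) * (4 * real k) \<le> card (parcs G)" by simp
    then have "2 * real k - 2 + 1 / real k \<le> card (parcs G) / (4 * real k)"
      using k by (simp add: pos_le_divide_eq)
    also have "\<dots> \<le> graph_spectral_radius G"
      using average_degree_le_spectral_radius(1)[OF pg ne] card by simp
    finally show ?thesis using spectral_radius_T_hat_less[OF k] by simp
  next
    case False
    have "W.arcs (pverts G) + card (parcs G) + 4 * k = 4 * k * (4 * k)"
      using arcs_nonadjacent[OF pg wf] card by simp
    then have "W.arcs (pverts G) + 4 > 8 * k\<^sup>2 + 4 * k"
      using False by (simp add: power2_eq_square)
    moreover have "even (W.arcs (pverts G))" "even (8 * k\<^sup>2 + 4 * k)" using W.even_arcs[OF fin] by simp_all
    \<comment> \<open>Two even numbers with a gap below 4 differ by at most 2; this is what brings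
      the deficit into the range of \<open>near_extremal_partition\<close>.\<close>
    moreover have "q \<le> p + 2" if "q < p + 4" "even p" "even q" for p q :: nat
      using that by presburger
    ultimately have "W.arcs (pverts G) + 2 \<ge> 8 * k\<^sup>2 + 4 * k" by blast
    moreover from this obtain A B where AB: "A \<union> B = pverts G" "A \<inter> B = {}" "W.matching A" "W.matching B"
      using W.near_extremal_partition[OF fin card] k by auto
    ultimately have ext: "W.near_extremal k A B"
      using fin finite_subset[of A "pverts G"] finite_subset[of B "pverts G"] card
      by (auto simp: W.near_extremal_def)
    have k1: "k \<ge> 1" using k by simp
    obtain \<phi> where \<phi>: "bij_betw \<phi> (pverts G) (pverts (T_hat (4 * k)))"
      "\<And>u v. u \<in> pverts G \<Longrightarrow> v \<in> pverts G \<Longrightarrow> (u, v) \<in> parcs G \<longleftrightarrow> (\<phi> u, \<phi> v) \<in> parcs (T_hat (4 * k))"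
      using near_extremal_iso_T_hat[OF wf pg conn k1 ext AB(1)] by blast
    show ?thesis
      using graph_spectral_radius_iso[OF fin \<phi>] digraph_isoI[OF pg \<phi> parcs_T_hat_subset[OF k1]] by simp
  qed
qed

theorem theorem5p4:
  fixes n :: nat
  assumes "n \<ge> 8" and "n mod 4 = 0"
  shows "T_hat n \<in> connected_graphs n 4 \<and>
    (\<forall>G :: 'a pair_pre_digraph. G \<in> connected_graphs n 4 \<longrightarrow>
       graph_spectral_radius (T_hat n) \<le> graph_spectral_radius G \<and>
       (graph_spectral_radius G = graph_spectral_radius (T_hat n) \<longrightarrow>
          digraph_iso (with_proj G) (with_proj (T_hat n))))"
proof -
  obtain k where n: "n = 4 * k" using assms(2) by auto
  have k: "k \<ge> 2" using assms(1) n by simp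
  show ?thesis
    unfolding n using T_hat_connected_graphs[OF k] connected_graphs_cases[OF _ k] by force
qed

end
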